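(* Let $X\subset\mathbb{RP}^3$ be the set of scaling classes of real cubics (binary cubic forms) which have exactly one real root and a pair of non-real complex conjugate roots, and define the complex-root map $\mathcal{R}_{\mathbb{C}}\colon X\to\mathbb{C}$ by letting $\mathcal{R}_{\mathbb{C}}(f)=z$ be the unique root of $f$ with positive imaginary part. Equip $X$ with the geometry of the hyperbolic plane's unit tangent bundle via the identification $\Psi\colon X\to\mathrm{UT}\mathbb{H}^2_{\mathrm{Coefs}}$ described in the context. Then $\mathcal{R}_{\mathbb{C}}$ factors as the bundle projection $\pi\colon\mathrm{UT}\mathbb{H}^2_{\mathrm{Coefs}}\to\mathbb{H}^2_{\mathrm{Coefs}}$ onto the projective model of the hyperbolic plane, followed by the isometry $\mathcal{R}_2\colon\mathbb{H}^2_{\mathrm{Coefs}}\to\mathbb{H}^2_{\mathrm{Roots}}\subset\mathbb{C}$ given by the quadratic formula; that is, $$\mathcal{R}_{\mathbb{C}}=\mathcal{R}_2\circ\pi\circ\Psi .$$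
   Context: Roots of binary cubic forms $ax^3+bx^2y+cxy^2+dy^3$ are taken in $\mathbb{CP}^1=\mathbb{C}\cup\{\infty\}$ ($[z:1]\leftrightarrow z$, $[1:0]\leftrightarrow\infty$). $\mathbb{H}^2_{\mathrm{Roots}}$ is the upper half plane with the metric $(dx^2+dy^2)/y^2$. $\mathbb{H}^2_{\mathrm{Coefs}}=\{[a:b:c]\in\mathbb{RP}^2\mid b^2<4ac\}$ is the projective model of the hyperbolic plane, with distance $\operatorname{arcosh}\frac{|2a_1c_2+2a_2c_1-b_1b_2|}{\sqrt{(4a_1c_1-b_1^2)(4a_2c_2-b_2^2)}}$, and $\mathcal{R}_2\colon\mathbb{H}^2_{\mathrm{Coefs}}\to\mathbb{H}^2_{\mathrm{Roots}}$ sends $[a:b:c]$ to the root of $ax^2+bx+c$ with positive imaginary part. $\mathrm{UT}$ denotes the unit tangent bundle. The identification $\Psi$: a cubic with roots $\{r,z,\overline z\}$, $r\in\mathbb{RP}^1=\partial_\infty\mathbb{H}^2_{\mathrm{Roots}}$, $\operatorname{Im}z>0$, is first sent to the unit tangent vector $v\in T_z\mathbb{H}^2_{\mathrm{Roots}}$ which is the initial vector of the geodesic ray from $z$ limiting to the ideal point $r$, and then transported to $\mathrm{UT}\mathbb{H}^2_{\mathrm{Coefs}}$ by the differential of the isometry $\mathcal{R}_2^{-1}$. This is the $\mathrm{PSL}(2;\mathbb{R})$-equivariant homeomorphism by which $X$ is regarded as the unit tangent bundle of the hyperbolic plane. *)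

theory Defs
  imports "HOL-Analysis.Analysis"
begin

section \<open>Real projective spaces\<close>

text \<open>\<^term>\<open>abs_proj v\<close> is the class of a nonzero vector \<open>v\<close> up to nonzero real scaling; it is unspecified for
  \<open>v = 0\<close>.\<close>

definition proj_rel :: "'a::real_vector \<Rightarrow> 'a \<Rightarrow> bool" where
  "proj_rel x y \<longleftrightarrow> x \<noteq> 0 \<and> (\<exists>k::real. k \<noteq> 0 \<and> y = k *\<^sub>R x)"

lemma part_equivp_proj_rel: "part_equivp (proj_rel :: 'a::euclidean_space \<Rightarrow> 'a \<Rightarrow> bool)"
proof (rule part_equivpI)
  obtain b :: 'a where "b \<in> Basis"
    using nonempty_Basis by blast
  then have "proj_rel b b"
    unfolding proj_rel_def by (auto intro!: exI[of _ 1])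
  then show "\<exists>x::'a. proj_rel x x" ..
  show "symp (proj_rel :: 'a \<Rightarrow> 'a \<Rightarrow> bool)"
  proof (rule sympI)
    fix x y :: 'a assume "proj_rel x y"
    then obtain k where "x \<noteq> 0" "k \<noteq> 0" "y = k *\<^sub>R x"
      unfolding proj_rel_def by blast
    then show "proj_rel y x"
      unfolding proj_rel_def by (auto intro!: exI[of _ "inverse k"])
  qed
  show "transp (proj_rel :: 'a \<Rightarrow> 'a \<Rightarrow> bool)"
  proof (rule transpI)
    fix x y z :: 'a assume "proj_rel x y" "proj_rel y z"
    then obtain k l where "x \<noteq> 0" "k \<noteq> 0" "l \<noteq> 0" "z = (l * k) *\<^sub>R x"
      unfolding proj_rel_def by auto
    then show "proj_rel x z"
      unfolding proj_rel_def by (metis mult_eq_0_iff)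
  qed
qed

quotient_type (overloaded) 'a proj = "'a::euclidean_space" / partial: proj_rel
  by (rule part_equivp_proj_rel)

type_synonym rp2 = "(real \<times> real \<times> real) proj"
type_synonym rp3 = "(real \<times> real \<times> real \<times> real) proj"


section \<open>Roots\<close>

text \<open>The Riemann sphere, with homogeneous coordinates. (The point at infinity is called \<open>Inft\<close>.)\<close>

datatype cp1 = Fin complex | Inft

fun hom_coords :: "cp1 \<Rightarrow> complex \<times> complex" where
  "hom_coords (Fin z) = (z, 1)"
| "hom_coords Inft = (1, 0)"

definition rp1 :: "cp1 set" where
  "rp1 = insert Inft (range (\<lambda>x::real. Fin (of_real x)))"

definition cubic_form :: "real \<times> real \<times> real \<times> real \<Rightarrow> complex \<times> complex \<Rightarrow> complex" where
  "cubic_form = (\<lambda>(a, b, c, d) (x, y).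
     of_real a * x ^ 3 + of_real b * x\<^sup>2 * y + of_real c * x * y\<^sup>2 + of_real d * y ^ 3)"

lemma cubic_form_scale: "cubic_form (k *\<^sub>R f) p = of_real k * cubic_form f p"
  by (simp add: cubic_form_def algebra_simps split: prod.splits)

lift_definition cubic_roots :: "rp3 \<Rightarrow> cp1 set" is
  "\<lambda>f. {w. cubic_form f (hom_coords w) = 0}"
  by (auto simp: proj_rel_def cubic_form_scale simp del: scaleR_Pair)

lift_definition quadratic_roots :: "rp2 \<Rightarrow> complex set" is
  "\<lambda>(a, b, c). {z. of_real a * z\<^sup>2 + of_real b * z + of_real c = 0}"
proof -
  fix u v :: "real \<times> real \<times> real" assume "proj_rel u v"
  then obtain k a b c where k: "k \<noteq> 0" and uv: "u = (a, b, c)" "v = (k * a, k * b, k * c)"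
    unfolding proj_rel_def by (cases u) auto
  have "of_real (k * a) * z\<^sup>2 + of_real (k * b) * z + of_real (k * c)
        = of_real k * (of_real a * z\<^sup>2 + of_real b * z + of_real c)" for z :: complex
    by (simp add: algebra_simps)
  with k show "(case u of (a, b, c) \<Rightarrow> {z::complex. of_real a * z\<^sup>2 + of_real b * z + of_real c = 0}) =
      (case v of (a, b, c) \<Rightarrow> {z. of_real a * z\<^sup>2 + of_real b * z + of_real c = 0})"
    unfolding uv by simp
qed

definition X :: "rp3 set" where
  "X = {f. \<exists>r z. r \<in> rp1 \<and> Im z > 0 \<and> cubic_roots f = {r, Fin z, Fin (cnj z)}}"

definition R_C :: "rp3 \<Rightarrow> complex" where
  "R_C f = (THE z. Im z > 0 \<and> Fin z \<in> cubic_roots f)"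


section \<open>The upper half plane\<close>

definition H2_Roots :: "complex set" where
  "H2_Roots = {z. Im z > 0}"

text \<open>The length of a tangent vector \<open>v\<close> at \<open>z\<close> for the metric \<open>(dx\<^sup>2 + dy\<^sup>2) / y\<^sup>2\<close>.\<close>

definition norm_Roots :: "complex \<Rightarrow> complex \<Rightarrow> real" where
  "norm_Roots z v = sqrt (((Re v)\<^sup>2 + (Im v)\<^sup>2) / (Im z)\<^sup>2)"

definition length_Roots :: "(real \<Rightarrow> complex) \<Rightarrow> real" where
  "length_Roots g = integral {0..1} (\<lambda>t. norm_Roots (g t) (vector_derivative g (at t)))"

text \<open>The infimum is over \<open>C\<^sup>1\<close> curves on the closed interval, so that their speed is continuous. The
  library's \<^const>\<open>valid_path\<close> would not do: it allows the derivative to be unbounded near finitely many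
  points, where the curve may have infinite length and \<^const>\<open>integral\<close> would return \<open>0\<close>.\<close>

definition dist_Roots :: "complex \<Rightarrow> complex \<Rightarrow> real" where
  "dist_Roots z w = Inf {length_Roots g | g.
     g C1_differentiable_on {0..1} \<and> path_image g \<subseteq> H2_Roots \<and> pathstart g = z \<and> pathfinish g = w}"

text \<open>Rays are parametrised by arc length on \<open>[0, \<infinity>)\<close>. In the hyperbolic plane every such geodesic is
  globally length-minimising, so the metric definition of geodesic applies.\<close>

definition geodesic_ray :: "(real \<Rightarrow> complex) \<Rightarrow> bool" where
  "geodesic_ray \<gamma> \<longleftrightarrow> \<gamma> ` {0..} \<subseteq> H2_Roots \<and>
     (\<forall>s\<ge>0. \<forall>t\<ge>0. dist_Roots (\<gamma> s) (\<gamma> t) = \<bar>s - t\<bar>)"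

fun limits_to :: "(real \<Rightarrow> complex) \<Rightarrow> cp1 \<Rightarrow> bool" where
  "limits_to \<gamma> (Fin w) \<longleftrightarrow> (\<gamma> \<longlongrightarrow> w) at_top"
| "limits_to \<gamma> Inft \<longleftrightarrow> filterlim \<gamma> at_infinity at_top"

definition ray_direction :: "complex \<Rightarrow> cp1 \<Rightarrow> complex" where
  "ray_direction z r = (THE v. \<exists>\<gamma>. geodesic_ray \<gamma> \<and> \<gamma> 0 = z \<and> limits_to \<gamma> r \<and>
     (\<gamma> has_vector_derivative v) (at 0 within {0..}))"


section \<open>The projective model\<close>

lift_definition negative_discriminant :: "rp2 \<Rightarrow> bool" is
  "\<lambda>(a, b, c). b\<^sup>2 < 4 * a * c"
proof -
  fix u v :: "real \<times> real \<times> real" assume "proj_rel u v"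
  then obtain k a b c where k: "k \<noteq> 0" and uv: "u = (a, b, c)" "v = (k * a, k * b, k * c)"
    unfolding proj_rel_def by (cases u) auto
  have "(k * b)\<^sup>2 < 4 * (k * a) * (k * c) \<longleftrightarrow> k\<^sup>2 * b\<^sup>2 < k\<^sup>2 * (4 * a * c)"
    by (simp add: power2_eq_square algebra_simps)
  also have "\<dots> \<longleftrightarrow> b\<^sup>2 < 4 * a * c"
    using k by (intro mult_less_cancel_left_pos) simp
  finally show "(case u of (a, b, c) \<Rightarrow> b\<^sup>2 < 4 * a * c) = (case v of (a, b, c) \<Rightarrow> b\<^sup>2 < 4 * a * c)"
    unfolding uv by simp
qed

definition H2_Coefs :: "rp2 set" where
  "H2_Coefs = {p. negative_discriminant p}"

lift_definition dist_Coefs :: "rp2 \<Rightarrow> rp2 \<Rightarrow> real" is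
  "\<lambda>(a1, b1, c1) (a2, b2, c2).
     arcosh (\<bar>2 * a1 * c2 + 2 * a2 * c1 - b1 * b2\<bar> /
             sqrt ((4 * a1 * c1 - b1\<^sup>2) * (4 * a2 * c2 - b2\<^sup>2)))"
proof -
  fix u u' v v' :: "real \<times> real \<times> real" assume "proj_rel u u'" "proj_rel v v'"
  then obtain k l a1 b1 c1 a2 b2 c2 where kl: "k \<noteq> 0" "l \<noteq> 0"
    and uv: "u = (a1, b1, c1)" "u' = (k * a1, k * b1, k * c1)"
      "v = (a2, b2, c2)" "v' = (l * a2, l * b2, l * c2)"
    unfolding proj_rel_def by (cases u; cases v) auto
  have "2 * (k * a1) * (l * c2) + 2 * (l * a2) * (k * c1) - (k * b1) * (l * b2)
      = (k * l) * (2 * a1 * c2 + 2 * a2 * c1 - b1 * b2)"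
    by (simp add: algebra_simps)
  moreover have "(4 * (k * a1) * (k * c1) - (k * b1)\<^sup>2) * (4 * (l * a2) * (l * c2) - (l * b2)\<^sup>2)
      = (k * l)\<^sup>2 * ((4 * a1 * c1 - b1\<^sup>2) * (4 * a2 * c2 - b2\<^sup>2))"
    by (simp add: power2_eq_square algebra_simps)
  ultimately have "\<bar>2 * (k * a1) * (l * c2) + 2 * (l * a2) * (k * c1) - (k * b1) * (l * b2)\<bar> /
        sqrt ((4 * (k * a1) * (k * c1) - (k * b1)\<^sup>2) * (4 * (l * a2) * (l * c2) - (l * b2)\<^sup>2))
      = \<bar>2 * a1 * c2 + 2 * a2 * c1 - b1 * b2\<bar> /
        sqrt ((4 * a1 * c1 - b1\<^sup>2) * (4 * a2 * c2 - b2\<^sup>2))"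
    using kl by (simp only: real_sqrt_mult real_sqrt_abs abs_mult) simp
  then show "(case u of (a1, b1, c1) \<Rightarrow> \<lambda>(a2, b2, c2).
       arcosh (\<bar>2 * a1 * c2 + 2 * a2 * c1 - b1 * b2\<bar> /
             sqrt ((4 * a1 * c1 - b1\<^sup>2) * (4 * a2 * c2 - b2\<^sup>2)))) v =
     (case u' of (a1, b1, c1) \<Rightarrow> \<lambda>(a2, b2, c2).
       arcosh (\<bar>2 * a1 * c2 + 2 * a2 * c1 - b1 * b2\<bar> /
             sqrt ((4 * a1 * c1 - b1\<^sup>2) * (4 * a2 * c2 - b2\<^sup>2)))) v'"
    unfolding uv by simp
qed

definition R_2 :: "rp2 \<Rightarrow> complex" where
  "R_2 p = (THE z. Im z > 0 \<and> z \<in> quadratic_roots p)"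

text \<open>\<^term>\<open>H2_Coefs\<close> is an open subset of the affine patch \<open>a \<noteq> 0\<close> of the projective plane, so
  \<open>[a : b : c] \<mapsto> (b / a, c / a)\<close> is a global chart. A tangent vector to \<^term>\<open>H2_Coefs\<close> is a pair of its base
  point and its coordinates in this chart.\<close>

lift_definition affine_chart :: "rp2 \<Rightarrow> real \<times> real" is
  "\<lambda>(a, b, c). (b / a, c / a)"
  by (auto simp: proj_rel_def)

definition affine_point :: "real \<times> real \<Rightarrow> rp2" where
  "affine_point = (\<lambda>(s, t). abs_proj (1, s, t))"

text \<open>The Riemannian norm is recovered from the distance as
  \<open>lim d(p, p + t w) / t\<close> for \<open>t \<rightarrow> 0\<^sup>+\<close>.\<close>

definition norm_Coefs :: "rp2 \<Rightarrow> real \<times> real \<Rightarrow> real" where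
  "norm_Coefs p w =
     Lim (at_right 0) (\<lambda>t. dist_Coefs p (affine_point (affine_chart p + t *\<^sub>R w)) / t)"

definition UT_Coefs :: "(rp2 \<times> (real \<times> real)) set" where
  "UT_Coefs = {(p, w). p \<in> H2_Coefs \<and> norm_Coefs p w = 1}"

definition bundle_proj :: "rp2 \<times> (real \<times> real) \<Rightarrow> rp2" where
  "bundle_proj = fst"


section \<open>The identification with the unit tangent bundle\<close>

text \<open>The differential of the inverse of \<^term>\<open>R_2\<close>, as a map of tangent bundles; the second component is
  computed in the chart.\<close>

definition R_2_inv :: "complex \<Rightarrow> rp2" where
  "R_2_inv = inv_into H2_Coefs R_2"

definition d_R_2_inv :: "complex \<times> complex \<Rightarrow> rp2 \<times> (real \<times> real)" where
  "d_R_2_inv = (\<lambda>(z, v). (R_2_inv z, frechet_derivative (affine_chart \<circ> R_2_inv) (at z) v))"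

definition Psi :: "rp3 \<Rightarrow> rp2 \<times> (real \<times> real)" where
  "Psi f = (THE u. \<exists>r z. r \<in> rp1 \<and> Im z > 0 \<and> cubic_roots f = {r, Fin z, Fin (cnj z)} \<and>
     u = d_R_2_inv (z, ray_direction z r))"

end

theory Submission
  imports Defs
begin

text \<open>A root \<open>z\<close> in the upper half plane corresponds to the point \<open>[1 : - 2 Re z : |z|\<^sup>2]\<close> of the projective
  model, and under this correspondence both distances are the arcosh of
  \<open>u(z, w) = 1 + |z - w|\<^sup>2 / (2 Im z Im w)\<close>. For the infimum over curves, \<open>u(z, \<cdot>)\<close> has gradient of hyperbolic
  length \<open>sqrt (u\<^sup>2 - 1)\<close>, so that \<open>arcosh (u + \<epsilon>)\<close> grows along a curve no faster than its length, while
  vertical lines and semicircles attain the bound.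

  A geodesic ray ending at \<open>r\<close> multiplies the Poisson kernel of \<open>r\<close> by \<open>e\<^sup>t\<close> and has unit speed, which determines
  its initial vector at \<open>z\<close> to be \<open>i Im z (z - r) / (cnj z - r)\<close>. As \<open>r\<close> runs through the real projective
  line, this runs exactly once through the unit circle at \<open>z\<close>; since a real cubic is determined by its
  roots up to scaling, \<open>\<Psi>\<close> is bijective, and its base point is the image of \<open>z\<close>.\<close>

section \<open>The distance of the upper half plane\<close>

definition cosh_dist :: "complex \<Rightarrow> complex \<Rightarrow> real" where
  "cosh_dist z w = 1 + (cmod (z - w))\<^sup>2 / (2 * Im z * Im w)"

lemma cosh_dist_ge_1: "Im z > 0 \<Longrightarrow> Im w > 0 \<Longrightarrow> cosh_dist z w \<ge> 1"
  by (simp add: cosh_dist_def)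

lemma cosh_dist_gradient_bound:
  fixes a b x0 y0 x y :: real
  assumes "y0 > 0" "y > 0"
  defines "u \<equiv> 1 + ((x0 - x)\<^sup>2 + (y0 - y)\<^sup>2) / (2 * y0 * y)"
  shows "((x - x0) / (y0 * y) * a + (1 / y0 - u / y) * b)\<^sup>2 \<le> (u\<^sup>2 - 1) * ((a\<^sup>2 + b\<^sup>2) / y\<^sup>2)"
proof -
  define p q where "p = (x - x0) / (y0 * y)" and "q = 1 / y0 - u / y"
  have u: "(x - x0)\<^sup>2 = 2 * y0 * y * u - y\<^sup>2 - y0\<^sup>2"
    using assms(1,2) unfolding u_def by (simp add: field_simps power2_eq_square)
  have "y\<^sup>2 * p\<^sup>2 = (x - x0)\<^sup>2 / y0\<^sup>2"
    using assms(1,2) by (simp add: p_def field_simps power2_eq_square)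
  also have "\<dots> = (2 * y0 * y * u - y\<^sup>2 - y0\<^sup>2) / y0\<^sup>2"
    by (simp only: u)
  also have "\<dots> = u\<^sup>2 - 1 - y\<^sup>2 * q\<^sup>2"
    using assms(1,2) by (simp add: q_def field_simps power2_eq_square)
  finally have pq: "u\<^sup>2 - 1 = y\<^sup>2 * (p\<^sup>2 + q\<^sup>2)"
    by (simp add: algebra_simps)
  have "(p * a + q * b)\<^sup>2 \<le> (p\<^sup>2 + q\<^sup>2) * (a\<^sup>2 + b\<^sup>2)"
    using zero_le_power2[of "p * b - q * a"] by (simp add: power2_eq_square algebra_simps)
  also have "\<dots> = (u\<^sup>2 - 1) * ((a\<^sup>2 + b\<^sup>2) / y\<^sup>2)"
    using assms(2) by (simp add: pq)
  finally show ?thesis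
    by (simp add: p_def q_def)
qed

lemma cosh_dist_has_derivative:
  assumes g: "(g has_vector_derivative d) (at t within S)" and "Im z > 0" "Im (g t) > 0"
  shows "((\<lambda>t. cosh_dist z (g t)) has_real_derivative
    ((Re (g t) - Re z) / (Im z * Im (g t)) * Re d + (1 / Im z - cosh_dist z (g t) / Im (g t)) * Im d))
    (at t within S)"
proof -
  have [derivative_intros]:
    "((\<lambda>t. Re (g t)) has_real_derivative Re d) (at t within S)"
    "((\<lambda>t. Im (g t)) has_real_derivative Im d) (at t within S)"
    using g by (simp_all add: has_vector_derivative_complex_iff)
  have eq: "(\<lambda>t. cosh_dist z (g t)) =
      (\<lambda>t. 1 + ((Re z - Re (g t))\<^sup>2 + (Im z - Im (g t))\<^sup>2) / (2 * Im z * Im (g t)))"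
    unfolding cosh_dist_def cmod_power2 by simp
  have "((\<lambda>t. cosh_dist z (g t)) has_real_derivative
    ((2 * (Re z - Re (g t)) * (- Re d) + 2 * (Im z - Im (g t)) * (- Im d)) * (2 * Im z * Im (g t))
      - ((Re z - Re (g t))\<^sup>2 + (Im z - Im (g t))\<^sup>2) * (2 * Im z * Im d))
    / ((2 * Im z * Im (g t)) * (2 * Im z * Im (g t)))) (at t within S)"
    unfolding eq using assms(2,3) by (auto intro!: derivative_eq_intros simp: algebra_simps)
  also have "((2 * (x0 - x) * (- a) + 2 * (y0 - y) * (- b)) * (2 * y0 * y) - q * (2 * y0 * b))
      / ((2 * y0 * y) * (2 * y0 * y))
      = (x - x0) / (y0 * y) * a + (1 / y0 - (1 + q / (2 * y0 * y)) / y) * b"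
    if "y0 > 0" "y > 0" for x x0 y y0 a b q :: real
  proof -
    define M where "M = 2 * y * (x - x0) * a + (2 * y * y - 2 * y0 * y - q) * b"
    have "(2 * (x0 - x) * (- a) + 2 * (y0 - y) * (- b)) * (2 * y0 * y) - q * (2 * y0 * b) = 2 * y0 * M"
      by (simp add: M_def algebra_simps)
    then have "((2 * (x0 - x) * (- a) + 2 * (y0 - y) * (- b)) * (2 * y0 * y) - q * (2 * y0 * b))
        / ((2 * y0 * y) * (2 * y0 * y)) = M / (2 * y0 * y * y)"
      using that by simp
    also have "\<dots> = 2 * y * (x - x0) / (2 * y0 * y * y) * a + (2 * y * y - 2 * y0 * y - q) / (2 * y0 * y * y) * b"
      by (simp add: M_def add_divide_distrib)
    also have "2 * y * (x - x0) / (2 * y0 * y * y) = (x - x0) / (y0 * y)"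
      using that by simp
    also have "(2 * y * y - 2 * y0 * y - q) / (2 * y0 * y * y) = 1 / y0 - (1 + q / (2 * y0 * y)) / y"
      using that by (simp add: field_simps)
    finally show ?thesis .
  qed
  note this[OF assms(2,3)]
  finally show ?thesis
    by (simp add: eq[THEN fun_cong])
qed

lemma length_Roots_ge:
  assumes g: "g C1_differentiable_on {0..1}" and sub: "path_image g \<subseteq> H2_Roots"
  shows "arcosh (cosh_dist (pathstart g) (pathfinish g)) \<le> length_Roots g"
proof -
  obtain D where D: "\<And>t. t \<in> {0..1} \<Longrightarrow> (g has_vector_derivative D t) (at t)"
    and contD: "continuous_on {0..1} D"
    using g unfolding C1_differentiable_on_def by blast
  have pos: "Im (g t) > 0" if "t \<in> {0..1}" for t
    using sub that by (auto simp: path_image_def H2_Roots_def image_subset_iff)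
  define z where "z = g 0"
  have z: "Im z > 0"
    unfolding z_def by (rule pos) simp
  define n where "n t = norm_Roots (g t) (D t)" for t
  have "continuous_on {0..1} g"
    using D by (intro continuous_at_imp_continuous_on) (blast intro: has_vector_derivative_continuous)
  then have "continuous_on {0..1} n"
    unfolding n_def norm_Roots_def using pos contD
    by (intro continuous_intros) (auto simp: less_imp_neq[symmetric])
  then have n_int: "n integrable_on {0..1}"
    by (rule integrable_continuous_interval)
  have "length_Roots g = integral {0..1} n"
    unfolding length_Roots_def n_def
    by (intro integral_cong) (simp add: vector_derivative_at[OF D])
  define u where "u t = cosh_dist z (g t)" for t
  define u' where "u' t = (Re (g t) - Re z) / (Im z * Im (g t)) * Re (D t)
    + (1 / Im z - u t / Im (g t)) * Im (D t)" for t
  have u1: "u t \<ge> 1" if "t \<in> {0..1}" for t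
    unfolding u_def using z pos[OF that] by (rule cosh_dist_ge_1)
  have u': "(u has_real_derivative u' t) (at t within {0..1})" if "t \<in> {0..1}" for t
    unfolding u_def[abs_def] u'_def
    by (rule cosh_dist_has_derivative[OF has_vector_derivative_at_within[OF D[OF that]] z pos[OF that]])
  have bound: "(u' t)\<^sup>2 \<le> ((u t)\<^sup>2 - 1) * (n t)\<^sup>2" if "t \<in> {0..1}" for t
    using cosh_dist_gradient_bound[OF z pos[OF that], of "Re (g t)" "Re z" "Re (D t)" "Im (D t)"]
    unfolding u'_def u_def n_def norm_Roots_def cosh_dist_def cmod_power2 by simp
  have le: "arcosh (u 1 + e) - arcosh (1 + e) \<le> integral {0..1} n" if e: "e > 0" for e
  proof -
    have "((\<lambda>t. u' t / sqrt ((u t + e)\<^sup>2 - 1)) has_integral arcosh (u 1 + e) - arcosh (u 0 + e)) {0..1}"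
    proof (rule fundamental_theorem_of_calculus)
      fix t :: real assume t: "t \<in> {0..1}"
      show "((\<lambda>t. arcosh (u t + e)) has_vector_derivative u' t / sqrt ((u t + e)\<^sup>2 - 1)) (at t within {0..1})"
        unfolding has_real_derivative_iff_has_vector_derivative[symmetric]
        using DERIV_chain2[OF arcosh_real_has_field_derivative DERIV_add[OF u'[OF t] DERIV_const[of e]]] u1[OF t] e
        by simp
    qed simp
    moreover have "(n has_integral integral {0..1} n) {0..1}"
      using n_int by (rule integrable_integral)
    moreover have "u' t / sqrt ((u t + e)\<^sup>2 - 1) \<le> n t" if t: "t \<in> {0..1}" for t
    proof -
      have 1: "(u t)\<^sup>2 \<le> (u t + e)\<^sup>2" "1 < (u t + e)\<^sup>2"
        using u1[OF t] e by (auto intro!: power_mono one_less_power)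
      have n0: "n t \<ge> 0"
        by (simp add: n_def norm_Roots_def)
      have "(u' t)\<^sup>2 \<le> ((u t + e)\<^sup>2 - 1) * (n t)\<^sup>2"
        using bound[OF t] mult_right_mono[of "(u t)\<^sup>2 - 1" "(u t + e)\<^sup>2 - 1" "(n t)\<^sup>2"] 1(1)
        by simp
      then have "\<bar>u' t\<bar> \<le> sqrt (((u t + e)\<^sup>2 - 1) * (n t)\<^sup>2)"
        by (metis real_sqrt_abs real_sqrt_le_iff)
      then have "u' t \<le> n t * sqrt ((u t + e)\<^sup>2 - 1)"
        using n0 by (simp add: real_sqrt_mult mult.commute)
      then show ?thesis
        using 1 by (simp add: pos_divide_le_eq)
    qed
    ultimately have "arcosh (u 1 + e) - arcosh (u 0 + e) \<le> integral {0..1} n"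
      by (rule has_integral_le)
    moreover have "u 0 = 1"
      by (simp add: u_def z_def cosh_dist_def)
    ultimately show ?thesis
      by simp
  qed
  have "((\<lambda>e. arcosh (u 1 + e) - arcosh (1 + e)) \<longlongrightarrow> arcosh (u 1 + 0) - arcosh (1 + 0)) (at_right 0)"
    using u1[of 1] by (intro tendsto_intros tendsto_arcosh_strong) (auto simp: eventually_at_filter)
  then have "arcosh (u 1 + 0) - arcosh (1 + 0) \<le> integral {0..1} n"
    by (rule tendsto_upperbound) (auto simp: eventually_at_filter le)
  then show ?thesis
    using \<open>length_Roots g = _\<close> by (simp add: u_def z_def pathstart_def pathfinish_def)
qed

lemma dist_Roots_between:
  assumes g: "g C1_differentiable_on {0..1}" "path_image g \<subseteq> H2_Roots" "pathstart g = z" "pathfinish g = w"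
  shows "dist_Roots z w \<in> {arcosh (cosh_dist z w) .. length_Roots g}"
proof -
  let ?L = "{length_Roots g |g. g C1_differentiable_on {0..1} \<and> path_image g \<subseteq> H2_Roots \<and>
    pathstart g = z \<and> pathfinish g = w}"
  have lower: "arcosh (cosh_dist z w) \<le> l" if "l \<in> ?L" for l
    using that length_Roots_ge by auto
  have mem: "length_Roots g \<in> ?L"
    using g by auto
  have "Inf ?L \<le> length_Roots g"
    by (rule cInf_lower[OF mem bdd_belowI[OF lower]])
  moreover have "arcosh (cosh_dist z w) \<le> Inf ?L"
    using mem by (intro cInf_greatest lower) auto
  ultimately show ?thesis
    unfolding dist_Roots_def by simp
qed

lemma dist_Roots_on_unit_speed_curve:
  assumes deriv: "\<And>t. (\<gamma> has_vector_derivative \<gamma>' t) (at t)" and cont: "continuous_on UNIV \<gamma>'"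
    and pos: "\<And>t. Im (\<gamma> t) > 0" and speed: "\<And>t. norm_Roots (\<gamma> t) (\<gamma>' t) = 1"
    and arc: "cosh_dist (\<gamma> a) (\<gamma> b) = cosh (a - b)"
  shows "dist_Roots (\<gamma> a) (\<gamma> b) = arcosh (cosh_dist (\<gamma> a) (\<gamma> b))"
proof -
  define g where "g t = \<gamma> (a + t * (b - a))" for t
  have g': "(g has_vector_derivative (b - a) *\<^sub>R \<gamma>' (a + t * (b - a))) (at t)" for t
  proof -
    have "((\<lambda>t. a + t * (b - a)) has_real_derivative (b - a)) (at t)"
      by (auto intro!: derivative_eq_intros)
    from vector_diff_chain_at[OF this[unfolded has_real_derivative_iff_has_vector_derivative] deriv]
    show ?thesis
      by (simp add: g_def[abs_def] o_def)
  qed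
  have C1: "g C1_differentiable_on {0..1}"
    unfolding C1_differentiable_on_def using g'
    by (intro exI[of _ "\<lambda>t. (b - a) *\<^sub>R \<gamma>' (a + t * (b - a))"] conjI ballI)
      (auto intro!: continuous_intros continuous_on_compose2[OF cont])
  have sub: "path_image g \<subseteq> H2_Roots"
    using pos by (auto simp: path_image_def g_def H2_Roots_def)
  have ends: "pathstart g = \<gamma> a" "pathfinish g = \<gamma> b"
    by (simp_all add: pathstart_def pathfinish_def g_def)
  have "norm_Roots (g t) (vector_derivative g (at t)) = \<bar>b - a\<bar>" for t
  proof -
    have "norm_Roots z (k *\<^sub>R v) = \<bar>k\<bar> * norm_Roots z v" for k z v
      unfolding norm_Roots_def real_sqrt_abs[symmetric] real_sqrt_mult[symmetric]
      by (simp add: power_mult_distrib algebra_simps add_divide_distrib)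
    then show ?thesis
      using speed by (simp add: vector_derivative_at[OF g'] g_def)
  qed
  then have "length_Roots g = \<bar>b - a\<bar>"
    by (simp add: length_Roots_def)
  moreover have "arcosh (cosh (a - b)) = \<bar>b - a\<bar>"
    by (metis abs_ge_zero abs_minus_commute arcosh_cosh_real cosh_real_abs)
  ultimately show ?thesis
    using dist_Roots_between[OF C1 sub ends] arc by simp
qed

lemma dist_Roots_vertical:
  assumes "Im z > 0" "Im w > 0" "Re z = Re w"
  shows "dist_Roots z w = arcosh (cosh_dist z w)"
proof -
  define \<gamma> where "\<gamma> t = Complex (Re z) (exp t)" for t
  have ends: "\<gamma> (ln (Im z)) = z" "\<gamma> (ln (Im w)) = w"
    using assms by (simp_all add: \<gamma>_def complex_eq_iff)
  have "dist_Roots (\<gamma> (ln (Im z))) (\<gamma> (ln (Im w))) = arcosh (cosh_dist (\<gamma> (ln (Im z))) (\<gamma> (ln (Im w))))"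
  proof (rule dist_Roots_on_unit_speed_curve)
    show "(\<gamma> has_vector_derivative Complex 0 (exp t)) (at t)" for t
      unfolding has_vector_derivative_complex_iff \<gamma>_def by (auto intro!: derivative_eq_intros)
    show "continuous_on UNIV (\<lambda>t. Complex 0 (exp t))"
      unfolding Complex_eq by (intro continuous_intros)
    show "cosh_dist (\<gamma> a) (\<gamma> b) = cosh (a - b)" for a b
      unfolding cosh_dist_def cmod_power2
      by (simp add: \<gamma>_def cosh_def exp_diff exp_minus field_simps power2_eq_square)
  qed (simp_all add: \<gamma>_def norm_Roots_def)
  then show ?thesis
    by (simp add: ends)
qed

lemma dist_Roots_semicircle:
  assumes "Im z > 0" "Im w > 0" "Re z \<noteq> Re w"
  shows "dist_Roots z w = arcosh (cosh_dist z w)"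
proof -
  define c where "c = ((cmod z)\<^sup>2 - (cmod w)\<^sup>2) / (Re z - Re w) / 2"
  define R where "R = cmod (z - of_real c)"
  have R_z: "R\<^sup>2 = (Re z - c)\<^sup>2 + (Im z)\<^sup>2"
    by (simp add: R_def cmod_power2)
  have "2 * c * (Re z - Re w) = (cmod z)\<^sup>2 - (cmod w)\<^sup>2"
  proof -
    have "2 * (q / d / 2) * d = q" if "d \<noteq> 0" for q d :: real
      using that by simp
    from this[of "Re z - Re w"] show ?thesis
      unfolding c_def using assms(3) by (simp only: right_minus_eq not_False_eq_True)
  qed
  then have R_w: "R\<^sup>2 = (Re w - c)\<^sup>2 + (Im w)\<^sup>2"
    unfolding R_z cmod_power2 by algebra
  have R: "R > 0"
    using assms(1) by (auto simp: R_def complex_eq_iff)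
  define \<gamma> where "\<gamma> t = Complex (c + R * (sinh t / cosh t)) (R / cosh t)" for t
  define s where "s v = arsinh ((Re v - c) / Im v)" for v
  have \<gamma>_s: "\<gamma> (s v) = v" if "Im v > 0" "R\<^sup>2 = (Re v - c)\<^sup>2 + (Im v)\<^sup>2" for v
  proof -
    have "((Re v - c) / Im v)\<^sup>2 + 1 = (R / Im v)\<^sup>2"
      using that by (simp add: power_divide field_simps)
    then have "cosh (s v) = R / Im v"
      using that R by (simp add: s_def cosh_arsinh_real)
    moreover have "sinh (s v) = (Re v - c) / Im v"
      by (simp add: s_def)
    ultimately show ?thesis
      using that R by (simp add: \<gamma>_def complex_eq_iff)
  qed
  have "dist_Roots (\<gamma> (s z)) (\<gamma> (s w)) = arcosh (cosh_dist (\<gamma> (s z)) (\<gamma> (s w)))"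
  proof (rule dist_Roots_on_unit_speed_curve)
    show "(\<gamma> has_vector_derivative Complex (R / (cosh t)\<^sup>2) (- R * sinh t / (cosh t)\<^sup>2)) (at t)" for t
    proof -
      have "(\<lambda>t. Re (\<gamma> t)) = (\<lambda>t. c + R * tanh t)" "(\<lambda>t. Im (\<gamma> t)) = (\<lambda>t. R / cosh t)"
        by (auto simp: \<gamma>_def tanh_def)
      moreover have "1 - (tanh t)\<^sup>2 = ((cosh t)\<^sup>2 - (sinh t)\<^sup>2) / (cosh t)\<^sup>2"
        by (simp add: tanh_def power_divide diff_divide_distrib)
      then have "1 - (tanh t)\<^sup>2 = 1 / (cosh t)\<^sup>2"
        by (simp only: hyperbolic_pythagoras)
      ultimately show ?thesis
        unfolding has_vector_derivative_complex_iff
        by (auto intro!: derivative_eq_intros simp: power2_eq_square)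
    qed
    show "continuous_on UNIV (\<lambda>t. Complex (R / (cosh t)\<^sup>2) (- R * sinh t / (cosh t)\<^sup>2))"
      unfolding Complex_eq by (intro continuous_intros) auto
    show "Im (\<gamma> t) > 0" for t
      using R by (simp add: \<gamma>_def)
    show "norm_Roots (\<gamma> t) (Complex (R / (cosh t)\<^sup>2) (- R * sinh t / (cosh t)\<^sup>2)) = 1" for t
    proof -
      have "(R / (cosh t)\<^sup>2)\<^sup>2 + (- R * sinh t / (cosh t)\<^sup>2)\<^sup>2 = R\<^sup>2 * (1 + (sinh t)\<^sup>2) / ((cosh t)\<^sup>2)\<^sup>2"
        by (simp add: power_divide power_mult_distrib add_divide_distrib algebra_simps)
      also have "1 + (sinh t)\<^sup>2 = (cosh t)\<^sup>2"
        by (simp add: cosh_square_eq)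
      also have "R\<^sup>2 * (cosh t)\<^sup>2 / ((cosh t)\<^sup>2)\<^sup>2 = (R / cosh t)\<^sup>2"
        by (simp add: power2_eq_square)
      finally show ?thesis
        using R by (simp add: norm_Roots_def \<gamma>_def)
    qed
    show "cosh_dist (\<gamma> (s z)) (\<gamma> (s w)) = cosh (s z - s w)"
    proof -
      define C D S T where "C = cosh (s z)" "D = cosh (s w)" "S = sinh (s z)" "T = sinh (s w)"
      have C: "C > 0" "D > 0" "C * C = S * S + 1" "D * D = T * T + 1"
        by (simp_all add: C_D_S_T_def cosh_square_eq[unfolded power2_eq_square])
      have "(C * D)\<^sup>2 * ((S / C - T / D)\<^sup>2 + (1 / C - 1 / D)\<^sup>2) = (S * D - T * C)\<^sup>2 + (D - C)\<^sup>2"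
        using C(1,2) by (simp add: power2_eq_square field_simps)
      also have "\<dots> = S * S * (D * D) + T * T * (C * C) - 2 * (S * D * T * C) + D * D + C * C - 2 * (C * D)"
        by (simp add: power2_eq_square algebra_simps)
      also have "\<dots> = 2 * (C * D) * (C * D - S * T - 1)"
        using C(3,4) by algebra
      finally have "(C * D) * ((C * D) * ((S / C - T / D)\<^sup>2 + (1 / C - 1 / D)\<^sup>2)) = (C * D) * (2 * (C * D - S * T - 1))"
        by (simp only: power2_eq_square ac_simps)
      then have "(C * D) * ((S / C - T / D)\<^sup>2 + (1 / C - 1 / D)\<^sup>2) = 2 * (C * D - S * T - 1)"
        by (rule mult_left_cancel[THEN iffD1, rotated]) (use C(1,2) in simp)
      then have "(S / C - T / D)\<^sup>2 + (1 / C - 1 / D)\<^sup>2 = 2 * (C * D - S * T - 1) / (C * D)"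
        using C(1,2) by (subst eq_divide_eq) (simp only: ac_simps, simp)
      then have "R\<^sup>2 * ((S / C - T / D)\<^sup>2 + (1 / C - 1 / D)\<^sup>2) / (2 * (R / C) * (R / D)) = C * D - S * T - 1"
        using C(1,2) R by (simp add: power2_eq_square)
      moreover have "R\<^sup>2 * ((S / C - T / D)\<^sup>2 + (1 / C - 1 / D)\<^sup>2)
          = (c + R * (S / C) - (c + R * (T / D)))\<^sup>2 + (R / C - R / D)\<^sup>2"
        by (simp add: power2_eq_square algebra_simps)
      ultimately show ?thesis
        unfolding cosh_dist_def \<gamma>_def cosh_diff C_D_S_T_def[symmetric] cmod_power2 by simp
    qed
  qed
  then show ?thesis
    using \<gamma>_s assms R_z R_w by simp
qed

lemma dist_Roots_eq_arcosh:
  assumes "Im z > 0" "Im w > 0"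
  shows "dist_Roots z w = arcosh (cosh_dist z w)"
  using assms dist_Roots_vertical dist_Roots_semicircle by (cases "Re z = Re w") auto

section \<open>Geodesic rays\<close>

lemma geodesic_ray_iff_cosh_dist:
  "geodesic_ray \<gamma> \<longleftrightarrow> (\<forall>t\<ge>0. Im (\<gamma> t) > 0) \<and> (\<forall>s\<ge>0. \<forall>t\<ge>0. cosh_dist (\<gamma> s) (\<gamma> t) = cosh (s - t))"
proof -
  have "dist_Roots z w = \<bar>d\<bar> \<longleftrightarrow> cosh_dist z w = cosh d" if "Im z > 0" "Im w > 0" for z w d
    using that by (metis abs_ge_zero arcosh_cosh_real cosh_arcosh_real cosh_dist_ge_1 cosh_real_abs
        dist_Roots_eq_arcosh)
  then show ?thesis
    unfolding geodesic_ray_def H2_Roots_def image_subset_iff by auto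
qed

fun poisson :: "complex \<Rightarrow> cp1 \<Rightarrow> real" where
  "poisson z (Fin w) = Im z / (cmod (z - w))\<^sup>2"
| "poisson z Inft = Im z"

text \<open>The logarithm of the limit is the Busemann cocycle of \<open>r\<close>.\<close>

lemma cosh_dist_ratio_tendsto:
  assumes r: "r \<in> rp1" and lim: "limits_to \<gamma> r"
    and pos: "Im z > 0" "Im z' > 0" "\<And>t. t \<ge> 0 \<Longrightarrow> Im (\<gamma> t) > 0"
  shows "((\<lambda>t. cosh_dist z (\<gamma> t) / cosh_dist z' (\<gamma> t)) \<longlongrightarrow> poisson z' r / poisson z r) at_top"
proof -
  define N where "N z w = (cmod z)\<^sup>2 + (cmod w)\<^sup>2 - 2 * Re z * Re w" for z w
  have N: "cosh_dist z w = N z w / (2 * Im z * Im w)" if "Im z > 0" "Im w > 0" for z w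
    unfolding cosh_dist_def N_def cmod_power2 using that
    by (simp add: field_simps power2_eq_square)
  have N_ratio: "cosh_dist z (\<gamma> t) / cosh_dist z' (\<gamma> t) = (N z (\<gamma> t) / Im z) / (N z' (\<gamma> t) / Im z')"
    if "t \<ge> 0" for t
    using pos(1,2) pos(3)[OF that] by (simp add: N)
  show ?thesis
  proof (cases r)
    case (Fin w)
    have w: "Im w = 0"
      using r Fin by (auto simp: rp1_def)
    have [tendsto_intros]: "(\<gamma> \<longlongrightarrow> w) at_top"
      using lim Fin by simp
    have N_w: "N z w = (cmod (z - w))\<^sup>2" if "Im z > 0" for z
      using w unfolding N_def cmod_power2 by (simp add: power2_eq_square algebra_simps)
    have N_lim: "((\<lambda>t. N z (\<gamma> t)) \<longlongrightarrow> N z w) at_top" for z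
      unfolding N_def by (intro tendsto_intros)
    have "z' \<noteq> w"
      using w pos(2) by auto
    then have "((\<lambda>t. (N z (\<gamma> t) / Im z) / (N z' (\<gamma> t) / Im z'))
        \<longlongrightarrow> ((cmod (z - w))\<^sup>2 / Im z) / ((cmod (z' - w))\<^sup>2 / Im z')) at_top"
      unfolding N_w[OF pos(1), symmetric] N_w[OF pos(2), symmetric] using pos
      by (intro tendsto_divide tendsto_const N_lim) (auto simp: N_w[OF pos(2)])
    then have "((\<lambda>t. (N z (\<gamma> t) / Im z) / (N z' (\<gamma> t) / Im z')) \<longlongrightarrow> poisson z' r / poisson z r) at_top"
      by (simp add: Fin mult.commute)
    then show ?thesis
    proof (rule Lim_transform_eventually)
      show "\<forall>\<^sub>F t in at_top. (N z (\<gamma> t) / Im z) / (N z' (\<gamma> t) / Im z') = cosh_dist z (\<gamma> t) / cosh_dist z' (\<gamma> t)"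
        using eventually_ge_at_top[of 0] by eventually_elim (simp only: N_ratio)
    qed
  next
    case Inft
    then have \<gamma>: "filterlim \<gamma> at_infinity at_top"
      using lim by simp
    then have inv: "((\<lambda>t. inverse (\<gamma> t)) \<longlongrightarrow> 0) at_top"
      by (rule filterlim_compose[OF tendsto_inverse_0])
    have "((\<lambda>t. N z (\<gamma> t) / (cmod (\<gamma> t))\<^sup>2) \<longlongrightarrow> 1) at_top" for z
    proof (rule Lim_transform_eventually)
      have "((\<lambda>t. (cmod z * cmod (inverse (\<gamma> t)))\<^sup>2 + 1 - 2 * Re z * Re (inverse (\<gamma> t)))
          \<longlongrightarrow> (cmod z * cmod 0)\<^sup>2 + 1 - 2 * Re z * Re 0) at_top"
        by (intro tendsto_intros inv)
      then show "((\<lambda>t. (cmod z * cmod (inverse (\<gamma> t)))\<^sup>2 + 1 - 2 * Re z * Re (inverse (\<gamma> t))) \<longlongrightarrow> 1) at_top"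
        by simp
      show "\<forall>\<^sub>F t in at_top. (cmod z * cmod (inverse (\<gamma> t)))\<^sup>2 + 1 - 2 * Re z * Re (inverse (\<gamma> t))
          = N z (\<gamma> t) / (cmod (\<gamma> t))\<^sup>2"
        using filterlim_at_infinity_imp_eventually_ne[OF \<gamma>, of 0]
      proof eventually_elim
        case (elim t)
        have inv: "Re (inverse (\<gamma> t)) = Re (\<gamma> t) / (cmod (\<gamma> t))\<^sup>2" "cmod (inverse (\<gamma> t)) = 1 / cmod (\<gamma> t)"
          by (simp add: cmod_power2) (simp add: norm_inverse divide_inverse)
        show ?case
          unfolding N_def inv using elim by (simp add: field_simps)
      qed
    qed
    then have "((\<lambda>t. (N z (\<gamma> t) / (cmod (\<gamma> t))\<^sup>2 / Im z) / (N z' (\<gamma> t) / (cmod (\<gamma> t))\<^sup>2 / Im z'))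
        \<longlongrightarrow> (1 / Im z) / (1 / Im z')) at_top"
      using pos by (intro tendsto_intros) auto
    then have "((\<lambda>t. (N z (\<gamma> t) / (cmod (\<gamma> t))\<^sup>2 / Im z) / (N z' (\<gamma> t) / (cmod (\<gamma> t))\<^sup>2 / Im z'))
        \<longlongrightarrow> poisson z' r / poisson z r) at_top"
      by (simp add: Inft)
    then show ?thesis
    proof (rule Lim_transform_eventually)
      show "\<forall>\<^sub>F t in at_top. (N z (\<gamma> t) / (cmod (\<gamma> t))\<^sup>2 / Im z) / (N z' (\<gamma> t) / (cmod (\<gamma> t))\<^sup>2 / Im z')
          = cosh_dist z (\<gamma> t) / cosh_dist z' (\<gamma> t)"
        using filterlim_at_infinity_imp_eventually_ne[OF \<gamma>, of 0] eventually_ge_at_top[of 0]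
        by eventually_elim (simp add: N_ratio)
    qed
  qed
qed

lemma poisson_on_geodesic_ray:
  assumes \<gamma>: "geodesic_ray \<gamma>" and r: "r \<in> rp1" and lim: "limits_to \<gamma> r" and s: "s \<ge> 0"
  shows "poisson (\<gamma> s) r = exp s * poisson (\<gamma> 0) r"
proof -
  have pos: "\<And>t. t \<ge> 0 \<Longrightarrow> Im (\<gamma> t) > 0"
    and d: "\<And>s t. s \<ge> 0 \<Longrightarrow> t \<ge> 0 \<Longrightarrow> cosh_dist (\<gamma> s) (\<gamma> t) = cosh (s - t)"
    using \<gamma> by (auto simp: geodesic_ray_iff_cosh_dist)
  have "((\<lambda>t. cosh_dist (\<gamma> 0) (\<gamma> t) / cosh_dist (\<gamma> s) (\<gamma> t)) \<longlongrightarrow> poisson (\<gamma> s) r / poisson (\<gamma> 0) r) at_top"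
    using cosh_dist_ratio_tendsto[OF r lim pos pos pos] s by simp
  moreover have "((\<lambda>t. cosh_dist (\<gamma> 0) (\<gamma> t) / cosh_dist (\<gamma> s) (\<gamma> t)) \<longlongrightarrow> exp s) at_top"
  proof (rule Lim_transform_eventually)
    have "((\<lambda>t::real. exp (- (2 * t))) \<longlongrightarrow> 0) at_top"
      by (intro filterlim_compose[OF exp_at_bot] filterlim_compose[OF filterlim_uminus_at_bot_at_top]
          filterlim_tendsto_pos_mult_at_top[OF tendsto_const _ filterlim_ident]) simp
    then have "((\<lambda>t. (1 + exp (- (2 * t))) / (exp (- s) + exp s * exp (- (2 * t))))
        \<longlongrightarrow> (1 + 0) / (exp (- s) + exp s * 0)) at_top"
      by (intro tendsto_intros) simp_all
    then show "((\<lambda>t. (1 + exp (- (2 * t))) / (exp (- s) + exp s * exp (- (2 * t)))) \<longlongrightarrow> exp s) at_top"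
      by (simp only: add_0_right mult_zero_right) (simp add: exp_minus inverse_eq_divide[symmetric])
    show "\<forall>\<^sub>F t in at_top. (1 + exp (- (2 * t))) / (exp (- s) + exp s * exp (- (2 * t)))
        = cosh_dist (\<gamma> 0) (\<gamma> t) / cosh_dist (\<gamma> s) (\<gamma> t)"
      using eventually_ge_at_top[of 0]
    proof eventually_elim
      case (elim t)
      have 1: "cosh t = exp t / 2 * (1 + exp (- (2 * t)))"
        by (simp add: cosh_def algebra_simps exp_add[symmetric])
      have 2: "cosh (s - t) = exp t / 2 * (exp (- s) + exp s * exp (- (2 * t)))"
        by (simp add: cosh_def algebra_simps exp_add[symmetric])
      have 3: "cosh_dist (\<gamma> 0) (\<gamma> t) = cosh t" "cosh_dist (\<gamma> s) (\<gamma> t) = cosh (s - t)"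
        using d[of 0 t] d[of s t] elim s by simp_all
      show ?case
        unfolding 3 1 2 by simp
    qed
  qed
  ultimately have "poisson (\<gamma> s) r / poisson (\<gamma> 0) r = exp s"
    by (intro tendsto_unique[OF trivial_limit_at_top_linorder])
  moreover have "poisson (\<gamma> 0) r \<noteq> 0"
    using pos[of 0] r by (cases r) (auto simp: rp1_def)
  ultimately show ?thesis
    by (simp add: field_simps)
qed

lemma geodesic_ray_initial_speed:
  assumes \<gamma>: "geodesic_ray \<gamma>" and v: "(\<gamma> has_vector_derivative v) (at 0 within {0..})"
  shows "(cmod v)\<^sup>2 = (Im (\<gamma> 0))\<^sup>2"
proof -
  define z where "z = \<gamma> 0"
  have z: "Im z > 0"
    using \<gamma> by (auto simp: geodesic_ray_iff_cosh_dist z_def)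
  have sq: "(cmod (\<gamma> s - z))\<^sup>2 = 4 * Im z * Im (\<gamma> s) * (sinh (s / 2))\<^sup>2" if "s \<ge> 0" for s
  proof -
    have "cosh_dist z (\<gamma> s) = cosh s" "Im (\<gamma> s) > 0"
      using \<gamma> that by (auto simp: geodesic_ray_iff_cosh_dist z_def)
    moreover have "cosh s = 1 + 2 * (sinh (s / 2))\<^sup>2"
      using cosh_add[of "s / 2" "s / 2"] cosh_square_eq[of "s / 2"] by (simp add: power2_eq_square)
    ultimately show ?thesis
      using z by (simp add: cosh_dist_def norm_minus_commute field_simps)
  qed
  have lims: "((\<lambda>s. (Re (\<gamma> s) - Re z) / s) \<longlongrightarrow> Re v) (at 0 within {0..})"
    "((\<lambda>s. (Im (\<gamma> s) - Im z) / s) \<longlongrightarrow> Im v) (at 0 within {0..})"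
    using v by (simp_all add: has_vector_derivative_complex_iff has_field_derivative_iff z_def)
  have lim1: "((\<lambda>s. ((Re (\<gamma> s) - Re z) / s)\<^sup>2 + ((Im (\<gamma> s) - Im z) / s)\<^sup>2) \<longlongrightarrow> (Re v)\<^sup>2 + (Im v)\<^sup>2) (at 0 within {0..})"
    by (intro tendsto_intros lims)
  have "((\<lambda>s::real. sinh (s / 2)) has_real_derivative 1 / 2) (at 0 within {0..})"
    by (auto intro!: derivative_eq_intros)
  then have "((\<lambda>s::real. sinh (s / 2) / s) \<longlongrightarrow> 1 / 2) (at 0 within {0..})"
    by (simp add: has_field_derivative_iff)
  moreover have "(\<gamma> \<longlongrightarrow> z) (at 0 within {0..})"
    using has_vector_derivative_continuous[OF v] by (simp add: continuous_within z_def)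
  ultimately have "((\<lambda>s. 4 * Im z * Im (\<gamma> s) * (sinh (s / 2) / s)\<^sup>2) \<longlongrightarrow> 4 * Im z * Im z * (1 / 2)\<^sup>2) (at 0 within {0..})"
    by (intro tendsto_mult tendsto_power tendsto_const tendsto_Im)
  moreover have "\<forall>\<^sub>F s in at 0 within {0..}. 4 * Im z * Im (\<gamma> s) * (sinh (s / 2) / s)\<^sup>2
      = ((Re (\<gamma> s) - Re z) / s)\<^sup>2 + ((Im (\<gamma> s) - Im z) / s)\<^sup>2"
    unfolding eventually_at_filter
    using sq by (intro always_eventually) (auto simp: cmod_power2 power_divide add_divide_distrib[symmetric])
  ultimately have "((\<lambda>s. ((Re (\<gamma> s) - Re z) / s)\<^sup>2 + ((Im (\<gamma> s) - Im z) / s)\<^sup>2)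
      \<longlongrightarrow> 4 * Im z * Im z * (1 / 2)\<^sup>2) (at 0 within {0..})"
    by (rule Lim_transform_eventually)
  with lim1 have "(Re v)\<^sup>2 + (Im v)\<^sup>2 = 4 * Im z * Im z * (1 / 2)\<^sup>2"
    by (intro tendsto_unique[where F = "at 0 within {0::real..}"]) (auto simp: at_within_Ici_at_right)
  then show ?thesis
    unfolding cmod_power2 z_def[symmetric] by (simp add: power2_eq_square)
qed

fun initial_vector :: "complex \<Rightarrow> cp1 \<Rightarrow> complex" where
  "initial_vector z (Fin w) = \<i> * of_real (Im z) * ((z - w) / (cnj z - w))"
| "initial_vector z Inft = \<i> * of_real (Im z)"

text \<open>The logarithmic derivative of the Poisson kernel along \<open>v\<close> is \<open>1\<close>, while its gradient and \<open>v\<close> both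
  have hyperbolic length \<open>1\<close>; the equality case of Cauchy--Schwarz determines \<open>v\<close>.\<close>

lemma geodesic_ray_initial_vector:
  assumes \<gamma>: "geodesic_ray \<gamma>" and r: "r \<in> rp1" and lim: "limits_to \<gamma> r"
    and v: "(\<gamma> has_vector_derivative v) (at 0 within {0..})"
  shows "v = initial_vector (\<gamma> 0) r"
proof -
  define z where "z = \<gamma> 0"
  have z: "Im z > 0"
    using \<gamma> by (auto simp: geodesic_ray_iff_cosh_dist z_def)
  have speed: "(Re v)\<^sup>2 + (Im v)\<^sup>2 = (Im z)\<^sup>2"
    using geodesic_ray_initial_speed[OF \<gamma> v] by (simp add: cmod_power2 z_def)
  have [derivative_intros]:
    "((\<lambda>t. Re (\<gamma> t)) has_real_derivative Re v) (at 0 within {0..})"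
    "((\<lambda>t. Im (\<gamma> t)) has_real_derivative Im v) (at 0 within {0..})"
    using v by (simp_all add: has_vector_derivative_complex_iff)
  have "((\<lambda>s. exp s * poisson z r) has_real_derivative poisson z r) (at 0 within {0..})"
    by (auto intro!: derivative_eq_intros)
  then have P: "((\<lambda>s. poisson (\<gamma> s) r) has_real_derivative poisson z r) (at 0 within {0..})"
    by (rule has_field_derivative_transform_within[OF _ zero_less_one])
      (simp_all add: z_def poisson_on_geodesic_ray[OF \<gamma> r lim, symmetric])
  have P_unique: "D = poisson z r" if "((\<lambda>s. poisson (\<gamma> s) r) has_real_derivative D) (at 0 within {0..})" for D
    using that P unfolding has_field_derivative_iff
    by (rule tendsto_unique[rotated]) (simp add: at_within_Ici_at_right)
  show ?thesis
  proof (cases r)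
    case Inft
    then have "Im v = Im z"
      using P_unique[of "Im v"] by (auto intro: derivative_intros)
    with speed show ?thesis
      using Inft by (simp add: complex_eq_iff z_def)
  next
    case (Fin w)
    then have w: "Im w = 0"
      using r by (auto simp: rp1_def)
    define x where "x = Re z - Re w"
    define y where "y = Im z"
    define D where "D = x\<^sup>2 + y\<^sup>2"
    define a b where "a = Re v" and "b = Im v"
    have D: "D > 0"
      using z by (simp add: D_def y_def add_nonneg_pos)
    have "((\<lambda>s. poisson (\<gamma> s) r) has_real_derivative
        (b * D - y * (2 * x * a + 2 * y * b)) / (D * D)) (at 0 within {0..})"
    proof -
      have "((\<lambda>s. Im (\<gamma> s) / ((Re (\<gamma> s) - Re w)\<^sup>2 + (Im (\<gamma> s))\<^sup>2)) has_real_derivative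
        (b * D - y * (2 * x * a + 2 * y * b)) / (D * D)) (at 0 within {0..})"
        using D by (auto intro!: derivative_eq_intros simp: a_def b_def x_def y_def z_def D_def)
      then show ?thesis
        by (simp add: Fin cmod_power2 w)
    qed
    then have "(b * D - y * (2 * x * a + 2 * y * b)) / (D * D) = y / D"
      using P_unique by (simp add: Fin cmod_power2 w D_def x_def y_def)
    moreover have "e = y * D" if "e / (D * D) = y / D" for e
    proof -
      have "e = e / (D * D) * (D * D)"
        using D by simp
      also have "\<dots> = y * D"
        using D by (simp add: that)
      finally show ?thesis .
    qed
    ultimately have 1: "b * D - y * (2 * x * a + 2 * y * b) = y * D"
      by blast
    have 2: "a\<^sup>2 + b\<^sup>2 = y\<^sup>2"
      using speed by (simp add: a_def b_def y_def)
    have "(b * D - y * (x\<^sup>2 - y\<^sup>2))\<^sup>2 + (a * D + 2 * x * y\<^sup>2)\<^sup>2 = 0"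
      using 1 2 unfolding D_def by algebra
    then have 3: "b * D = y * (x\<^sup>2 - y\<^sup>2)" "a * D = - 2 * x * y\<^sup>2"
      by (simp_all add: sum_power2_eq_zero_iff)
    have "(a * x + b * y) * D = - (y\<^sup>2) * D" "(b * x - a * y) * D = y * x * D"
      using 3 unfolding D_def by algebra+
    then have "a * x + b * y = - (y\<^sup>2)" "b * x - a * y = y * x"
      using D by (metis mult_right_cancel less_irrefl)+
    then have "v * (cnj z - w) = \<i> * of_real (Im z) * (z - w)"
      using w by (simp add: complex_eq_iff a_def b_def x_def y_def power2_eq_square algebra_simps)
    moreover have "cnj z - w \<noteq> 0"
      using w z by (auto simp: complex_eq_iff)
    ultimately show ?thesis
      using Fin by (simp add: z_def field_simps)
  qed
qed

lemma cosh_dist_inversion: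
  assumes "Im a > 0" "Im b > 0" "Im w = 0"
  shows "cosh_dist (w - inverse a) (w - inverse b) = cosh_dist a b"
proof -
  have ab: "a \<noteq> 0" "b \<noteq> 0"
    using assms by auto
  have "w - inverse a - (w - inverse b) = (a - b) / (a * b)"
    using ab by (simp add: field_simps)
  then have "(cmod (w - inverse a - (w - inverse b)))\<^sup>2 = (cmod (a - b))\<^sup>2 / ((cmod a)\<^sup>2 * (cmod b)\<^sup>2)"
    by (simp add: norm_divide norm_mult power_divide power_mult_distrib)
  moreover have "Im (w - inverse c) = Im c / (cmod c)\<^sup>2" for c
    using assms(3) by (simp add: cmod_power2)
  ultimately show ?thesis
    using ab by (simp add: cosh_dist_def)
qed

lemma geodesic_ray_vertical:
  assumes "y > 0"
  shows "geodesic_ray (\<lambda>t. Complex x (y * exp t))"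
  unfolding geodesic_ray_iff_cosh_dist cosh_dist_def cmod_power2 using assms
  by (simp add: cosh_def exp_diff exp_minus field_simps power2_eq_square)

lemma filterlim_vertical_ray:
  assumes "y > 0"
  shows "filterlim (\<lambda>t. Complex x (y * exp t)) at_infinity at_top"
proof (rule filterlim_norm_at_top_imp_at_infinity)
  have "filterlim (\<lambda>t. y * exp t) at_top at_top"
    using assms by (intro filterlim_tendsto_pos_mult_at_top[OF tendsto_const] exp_at_top)
  then show "filterlim (\<lambda>t. norm (Complex x (y * exp t))) at_top at_top"
    by (rule filterlim_at_top_mono) (auto intro!: always_eventually order.trans[OF _ abs_Im_le_cmod])
qed

lemma vertical_ray_has_vector_derivative:
  "((\<lambda>t. Complex x (y * exp t)) has_vector_derivative Complex 0 (y * exp t)) (at t within S)"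
  unfolding has_vector_derivative_complex_iff by (auto intro!: derivative_eq_intros)

text \<open>A ray to a finite ideal point \<open>w\<close> is the image of a vertical one under the isometry
  \<open>a \<mapsto> w - 1 / a\<close>, which sends \<open>\<infinity>\<close> to \<open>w\<close>.\<close>

lemma geodesic_ray_exists:
  assumes z: "Im z > 0" and r: "r \<in> rp1"
  obtains \<gamma> v where "geodesic_ray \<gamma>" "\<gamma> 0 = z" "limits_to \<gamma> r" "(\<gamma> has_vector_derivative v) (at 0 within {0..})"
proof (cases r)
  case Inft
  show thesis
    by (rule that[OF geodesic_ray_vertical[OF z] _ _ vertical_ray_has_vector_derivative, of "Re z"])
      (simp_all add: Inft filterlim_vertical_ray z complex_eq_iff)
next
  case (Fin w)
  then have w: "Im w = 0"
    using r by (auto simp: rp1_def)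
  define a where "a = inverse (w - z)"
  have a: "Im a > 0"
    using w z by (simp add: a_def add_nonneg_pos)
  define h where "h t = Complex (Re a) (Im a * exp t)" for t
  have h: "geodesic_ray h" "h 0 = a"
    using geodesic_ray_vertical[OF a] by (simp_all add: h_def[abs_def])
  have h0: "h t \<noteq> 0" for t
    using a by (simp add: h_def complex_eq_iff)
  have "geodesic_ray (\<lambda>t. w - inverse (h t))"
    unfolding geodesic_ray_iff_cosh_dist
  proof (intro conjI allI impI)
    fix s t :: real assume "s \<ge> 0" "t \<ge> 0"
    with h(1) have st: "Im (h s) > 0" "Im (h t) > 0" "cosh_dist (h s) (h t) = cosh (s - t)"
      by (auto simp: geodesic_ray_iff_cosh_dist)
    then show "cosh_dist (w - inverse (h s)) (w - inverse (h t)) = cosh (s - t)"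
      using cosh_dist_inversion w by simp
    show "Im (w - inverse (h s)) > 0"
      using st w by (simp add: add_nonneg_pos)
  qed
  moreover have "w - inverse (h 0) = z"
    by (simp add: h(2) a_def)
  moreover have "((\<lambda>t. w - inverse (h t)) \<longlongrightarrow> w - 0) at_top"
    unfolding h_def by (intro tendsto_intros filterlim_compose[OF tendsto_inverse_0] filterlim_vertical_ray a)
  moreover obtain v where "((\<lambda>t. w - inverse (h t)) has_vector_derivative v) (at 0 within {0..})"
  proof -
    have "h differentiable at 0"
      using vertical_ray_has_vector_derivative[of "Re a" "Im a" 0 UNIV]
      by (auto simp: h_def[abs_def] intro: differentiableI_vector)
    then have "(\<lambda>t. w - inverse (h t)) differentiable at 0"
      using h0 by (intro derivative_intros) auto
    then show thesis
      using that by (auto simp: vector_derivative_works intro: has_vector_derivative_at_within)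
  qed
  ultimately show thesis
    by (intro that) (simp_all add: Fin)
qed

lemma ray_direction_eq:
  assumes "Im z > 0" "r \<in> rp1"
  shows "ray_direction z r = initial_vector z r"
  unfolding ray_direction_def
proof (rule the_equality)
  show "\<exists>\<gamma>. geodesic_ray \<gamma> \<and> \<gamma> 0 = z \<and> limits_to \<gamma> r \<and>
      (\<gamma> has_vector_derivative initial_vector z r) (at 0 within {0..})"
    using geodesic_ray_exists[OF assms] geodesic_ray_initial_vector[OF _ assms(2)] by metis
  show "v = initial_vector z r" if "\<exists>\<gamma>. geodesic_ray \<gamma> \<and> \<gamma> 0 = z \<and> limits_to \<gamma> r \<and>
      (\<gamma> has_vector_derivative v) (at 0 within {0..})" for v
    using that geodesic_ray_initial_vector[OF _ assms(2)] by blast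
qed

lemma bij_betw_initial_vector:
  assumes z: "Im z > 0"
  shows "bij_betw (initial_vector z) rp1 {v. cmod v = Im z}"
proof -
  have nz: "cnj z - of_real x \<noteq> 0" "z - of_real x \<noteq> 0" for x
    using z by (auto simp: complex_eq_iff)
  have z_cnj: "z \<noteq> cnj z"
    using z by (simp add: complex_eq_iff)
  have "inj_on (initial_vector z) rp1"
  proof (rule inj_onI)
    have "x = x'" if "(z - of_real x) / (cnj z - of_real x) = (z - of_real x') / (cnj z - of_real x')" for x x'
    proof -
      have "(z - of_real x) * (cnj z - of_real x') = (z - of_real x') * (cnj z - of_real x)"
        using that nz by (simp add: frac_eq_eq)
      then have "(z - cnj z) * (of_real x - of_real x') = 0"
        by (simp add: algebra_simps)
      then show ?thesis
        using z by (auto simp: complex_eq_iff)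
    qed
    then show "r = r'" if "r \<in> rp1" "r' \<in> rp1" "initial_vector z r = initial_vector z r'" for r r'
      using that z z_cnj nz by (auto simp: rp1_def simp del: times_divide_eq_right)
  qed
  moreover have "initial_vector z ` rp1 = {v. cmod v = Im z}"
  proof (intro equalityI subsetI)
    fix v assume "v \<in> initial_vector z ` rp1"
    moreover have "cmod (z - of_real x) = cmod (cnj z - of_real x)" for x
      by (metis complex_cnj_complex_of_real complex_cnj_diff complex_mod_cnj)
    ultimately show "v \<in> {v. cmod v = Im z}"
      using z nz by (auto simp: rp1_def norm_mult norm_divide)
  next
    fix v assume "v \<in> {v. cmod v = Im z}"
    then have cv: "v * cnj v = of_real ((Im z)\<^sup>2)"
      by (simp add: complex_norm_square[symmetric])
    define e where "e = v / (\<i> * of_real (Im z))"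
    have v: "v = \<i> * of_real (Im z) * e"
      using z by (simp add: e_def)
    have e: "e * cnj e = 1"
      using cv z by (simp add: e_def power2_eq_square)
    show "v \<in> initial_vector z ` rp1"
    proof (cases "e = 1")
      case True
      then show ?thesis
        unfolding v by (intro image_eqI[of _ _ Inft]) (auto simp: rp1_def)
    next
      case False
      define x where "x = (z - e * cnj z) / (1 - e)"
      have e': "1 - e \<noteq> 0" "1 - cnj e \<noteq> 0"
        using False by (auto simp: complex_eq_iff)
      have "(cnj z - cnj e * z) * (1 - e) = (z - e * cnj z) * (1 - cnj e)"
        using e by algebra
      then have "cnj x = x"
        using e' by (simp add: x_def frac_eq_eq)
      then have x: "x = of_real (Re x)"
        by (simp add: complex_eq_iff)
      have "x * (1 - e) = z - e * cnj z"
        using e' by (simp add: x_def)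
      then have "z - x = e * (cnj z - x)"
        by (simp add: algebra_simps)
      then have "initial_vector z (Fin x) = v"
        using nz(1)[of "Re x"] x unfolding v by simp
      moreover have "Fin x \<in> rp1"
        using x by (auto simp: rp1_def)
      ultimately show ?thesis
        by blast
    qed
  qed
  ultimately show ?thesis
    by (simp add: bij_betw_def)
qed

section \<open>The projective model\<close>

lemma proj_rel_refl_iff [simp]: "proj_rel x x \<longleftrightarrow> x \<noteq> 0"
  unfolding proj_rel_def by (auto intro!: exI[of _ 1])

lemma abs_proj_cases:
  obtains v where "v \<noteq> 0" "p = abs_proj v"
proof -
  have "\<exists>v. v \<noteq> 0 \<and> p = abs_proj v"
    by (rule proj.abs_induct[of _ p]) auto
  then show thesis
    using that by blast
qed

lemma abs_proj_scale:
  assumes "v \<noteq> 0" "k \<noteq> 0"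
  shows "abs_proj (k *\<^sub>R v) = abs_proj v"
proof -
  have "proj_rel v (k *\<^sub>R v)"
    using assms by (auto simp: proj_rel_def)
  then show ?thesis
    using Quotient3_rel_abs[OF Quotient3_proj] by metis
qed

definition coefs_of_root :: "complex \<Rightarrow> rp2" where
  "coefs_of_root z = abs_proj (1, - 2 * Re z, (cmod z)\<^sup>2)"

lemma affine_point_nonzero: "(1 :: real, s, t) \<noteq> (0 :: real \<times> real \<times> real)"
  by (simp add: zero_prod_def)

lemma H2_Coefs_cases:
  assumes "p \<in> H2_Coefs"
  obtains z where "Im z > 0" "p = coefs_of_root z"
proof -
  obtain v where v: "v \<noteq> 0" "p = abs_proj v"
    by (rule abs_proj_cases)
  obtain a b c where abc: "v = (a, b, c)"
    by (cases v)
  have neg: "b\<^sup>2 < 4 * a * c"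
    using assms v by (simp add: H2_Coefs_def abc negative_discriminant.abs_eq)
  have a: "a \<noteq> 0"
    using neg by auto
  define z where "z = Complex (- b / (2 * a)) (sqrt (4 * a * c - b\<^sup>2) / (2 * \<bar>a\<bar>))"
  have "(cmod z)\<^sup>2 = b\<^sup>2 / (2 * a)\<^sup>2 + (4 * a * c - b\<^sup>2) / (2 * a)\<^sup>2"
    unfolding cmod_power2 using neg by (simp add: z_def power_divide power_mult_distrib)
  also have "\<dots> = c / a"
    using a by (simp add: add_divide_distrib[symmetric] power2_eq_square)
  finally have "v = a *\<^sub>R (1, - 2 * Re z, (cmod z)\<^sup>2)"
    using a by (simp add: abc z_def)
  then have "p = coefs_of_root z"
    using v a unfolding coefs_of_root_def by (metis abs_proj_scale affine_point_nonzero)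
  moreover have "Im z > 0"
    using neg a by (simp add: z_def)
  ultimately show thesis
    by (rule that[rotated])
qed

lemma coefs_of_root_in_H2_Coefs: "Im z > 0 \<Longrightarrow> coefs_of_root z \<in> H2_Coefs"
  by (simp add: H2_Coefs_def coefs_of_root_def negative_discriminant.abs_eq affine_point_nonzero
      cmod_power2 power_mult_distrib)

lemma quadratic_roots_coefs_of_root: "quadratic_roots (coefs_of_root z) = {z, cnj z}"
proof -
  have "w\<^sup>2 + of_real (- 2 * Re z) * w + of_real ((cmod z)\<^sup>2) = (w - z) * (w - cnj z)" for w
  proof -
    have sum: "of_real (- 2 * Re z) = - (z + cnj z)"
      by (simp add: complex_add_cnj)
    show ?thesis
      unfolding complex_norm_square sum by (simp add: algebra_simps power2_eq_square del: complex_add_cnj)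
  qed
  then show ?thesis
    unfolding coefs_of_root_def by (auto simp: quadratic_roots.abs_eq affine_point_nonzero)
qed

lemma R_2_coefs_of_root:
  assumes "Im z > 0"
  shows "R_2 (coefs_of_root z) = z"
  unfolding R_2_def quadratic_roots_coefs_of_root using assms by (intro the_equality) auto

lemma bij_betw_R_2: "bij_betw R_2 H2_Coefs H2_Roots"
  by (rule bij_betw_byWitness[where f' = coefs_of_root])
    (auto simp: H2_Roots_def R_2_coefs_of_root coefs_of_root_in_H2_Coefs elim!: H2_Coefs_cases)

lemma R_2_inv_eq_coefs_of_root:
  assumes "Im z > 0"
  shows "R_2_inv z = coefs_of_root z"
  using inv_into_f_f[OF bij_betw_imp_inj_on[OF bij_betw_R_2] coefs_of_root_in_H2_Coefs[OF assms]] assms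
  by (simp add: R_2_inv_def R_2_coefs_of_root)

lemma affine_chart_coefs_of_root: "affine_chart (coefs_of_root z) = (- 2 * Re z, (cmod z)\<^sup>2)"
  by (simp add: coefs_of_root_def affine_chart.abs_eq affine_point_nonzero)

lemma dist_Coefs_coefs_of_root:
  assumes "Im z > 0" "Im w > 0"
  shows "dist_Coefs (coefs_of_root z) (coefs_of_root w) = arcosh (cosh_dist z w)"
proof -
  have "\<bar>2 * 1 * (cmod w)\<^sup>2 + 2 * 1 * (cmod z)\<^sup>2 - (- 2 * Re z) * (- 2 * Re w)\<bar> / sqrt ((4 * 1 * (cmod z)\<^sup>2
      - (- 2 * Re z)\<^sup>2) * (4 * 1 * (cmod w)\<^sup>2 - (- 2 * Re w)\<^sup>2)) = cosh_dist z w"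
  proof -
    have "(4 * 1 * (cmod z)\<^sup>2 - (- 2 * Re z)\<^sup>2) * (4 * 1 * (cmod w)\<^sup>2 - (- 2 * Re w)\<^sup>2) = (4 * Im z * Im w)\<^sup>2"
      unfolding cmod_power2 by (simp add: power_mult_distrib)
    then have 1: "sqrt ((4 * 1 * (cmod z)\<^sup>2 - (- 2 * Re z)\<^sup>2) * (4 * 1 * (cmod w)\<^sup>2 - (- 2 * Re w)\<^sup>2)) = 4 * Im z * Im w"
      using assms by simp
    have 2: "2 * 1 * (cmod w)\<^sup>2 + 2 * 1 * (cmod z)\<^sup>2 - (- 2 * Re z) * (- 2 * Re w)
        = 2 * ((cmod (z - w))\<^sup>2 + 2 * Im z * Im w)"
      unfolding cmod_power2 by (simp add: power2_eq_square algebra_simps)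
    have "(cmod (z - w))\<^sup>2 + 2 * Im z * Im w \<ge> 0"
      using assms by simp
    then show ?thesis
      unfolding 1 2 cosh_dist_def using assms by (simp add: field_simps)
  qed
  then show ?thesis
    unfolding coefs_of_root_def by (simp add: dist_Coefs.abs_eq affine_point_nonzero)
qed

definition d_coefs :: "complex \<Rightarrow> complex \<Rightarrow> real \<times> real" where
  "d_coefs z v = (- 2 * Re v, 2 * (Re z * Re v + Im z * Im v))"

lemma d_R_2_inv_eq:
  assumes "Im z > 0"
  shows "d_R_2_inv (z, v) = (coefs_of_root z, d_coefs z v)"
proof -
  have "((\<lambda>z. (- 2 * Re z, (Re z)\<^sup>2 + (Im z)\<^sup>2)) has_derivative d_coefs z) (at z)"
    unfolding d_coefs_def[abs_def] by (auto intro!: derivative_eq_intros simp: algebra_simps)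
  then have "(affine_chart \<circ> R_2_inv has_derivative d_coefs z) (at z)"
    by (rule has_derivative_transform_within_open[OF _ open_halfspace_Im_gt[of 0]])
      (simp_all add: assms R_2_inv_eq_coefs_of_root affine_chart_coefs_of_root cmod_power2)
  then have "frechet_derivative (affine_chart \<circ> R_2_inv) (at z) = d_coefs z"
    by (rule frechet_derivative_at[symmetric])
  then show ?thesis
    using assms by (simp add: d_R_2_inv_def R_2_inv_eq_coefs_of_root)
qed

lemma bij_d_coefs:
  assumes "Im z > 0"
  shows "bij (d_coefs z)"
proof (rule o_bij)
  let ?g = "\<lambda>(s, t). Complex (- s / 2) ((t + Re z * s) / (2 * Im z))"
  show "?g \<circ> d_coefs z = id"
    using assms by (auto simp: fun_eq_iff d_coefs_def complex_eq_iff field_simps)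
  show "d_coefs z \<circ> ?g = id"
    using assms by (auto simp: fun_eq_iff d_coefs_def field_simps)
qed

lemma arcosh_eq_arsinh:
  fixes x :: real
  assumes "x \<ge> 1"
  shows "arcosh x = arsinh (sqrt (x\<^sup>2 - 1))"
  using assms by (metis arsinh_sinh_real sinh_arcosh_real)

lemma dist_Coefs_affine_line:
  fixes z v :: complex and t :: real
  defines "E \<equiv> \<lambda>t. (Im z)\<^sup>2 + 2 * t * Im z * Im v - t\<^sup>2 * (Re v)\<^sup>2"
  assumes z: "Im z > 0" and t: "t > 0" and E: "E t > 0"
  shows "dist_Coefs (coefs_of_root z) (affine_point (affine_chart (coefs_of_root z) + t *\<^sub>R d_coefs z v))
    = arsinh (t * cmod v / sqrt (E t))"
proof -
  define x y a b where xyab: "x = Re z" "y = Im z" "a = Re v" "b = Im v"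
  define N where "N = 4 * (y\<^sup>2 + t * y * b)"
  define q where "q = \<bar>N\<bar> / sqrt (4 * y\<^sup>2 * (4 * E t))"
  have y: "y > 0"
    using z by (simp add: xyab)
  have point: "affine_point (affine_chart (coefs_of_root z) + t *\<^sub>R d_coefs z v)
      = abs_proj (1, - 2 * x - 2 * t * a, x\<^sup>2 + y\<^sup>2 + 2 * t * (x * a + y * b))"
    unfolding affine_point_def affine_chart_coefs_of_root d_coefs_def xyab cmod_power2
    by (simp add: algebra_simps)
  have "2 * 1 * (x\<^sup>2 + y\<^sup>2 + 2 * t * (x * a + y * b)) + 2 * 1 * (x\<^sup>2 + y\<^sup>2) - (- 2 * x) * (- 2 * x - 2 * t * a) = N"
    "(4 * 1 * (x\<^sup>2 + y\<^sup>2) - (- 2 * x)\<^sup>2) = 4 * y\<^sup>2"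
    "4 * 1 * (x\<^sup>2 + y\<^sup>2 + 2 * t * (x * a + y * b)) - (- 2 * x - 2 * t * a)\<^sup>2 = 4 * E t"
    unfolding N_def E_def xyab[symmetric] by (simp_all add: power2_eq_square algebra_simps)
  then have "dist_Coefs (abs_proj (1, - 2 * x, x\<^sup>2 + y\<^sup>2))
      (abs_proj (1, - 2 * x - 2 * t * a, x\<^sup>2 + y\<^sup>2 + 2 * t * (x * a + y * b))) = arcosh q"
    unfolding q_def by (subst dist_Coefs.abs_eq) (simp_all only: affine_point_nonzero proj_rel_refl_iff prod.case not_False_eq_True)
  then have d: "dist_Coefs (coefs_of_root z) (affine_point (affine_chart (coefs_of_root z) + t *\<^sub>R d_coefs z v)) = arcosh q"
    unfolding point by (simp add: coefs_of_root_def cmod_power2 xyab)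
  have sq: "N\<^sup>2 - 4 * y\<^sup>2 * (4 * E t) = 16 * y\<^sup>2 * (t\<^sup>2 * (a\<^sup>2 + b\<^sup>2))"
    unfolding N_def E_def xyab[symmetric] by (simp add: power2_eq_square algebra_simps)
  have pos: "4 * y\<^sup>2 * (4 * E t) > 0"
    using y E by simp
  have "q\<^sup>2 - 1 = N\<^sup>2 / (4 * y\<^sup>2 * (4 * E t)) - 1"
    using pos by (simp only: q_def power_divide power2_abs real_sqrt_pow2 less_imp_le)
  also have "\<dots> = (N\<^sup>2 - 4 * y\<^sup>2 * (4 * E t)) / (4 * y\<^sup>2 * (4 * E t))"
    using y E by (simp add: diff_divide_distrib)
  also have "\<dots> = t\<^sup>2 * (a\<^sup>2 + b\<^sup>2) / E t"
    unfolding sq using y by simp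
  also have "\<dots> = (t * cmod v / sqrt (E t))\<^sup>2"
    using E by (simp add: power_divide power_mult_distrib cmod_power2 xyab)
  finally have q: "q\<^sup>2 - 1 = (t * cmod v / sqrt (E t))\<^sup>2" .
  have "q\<^sup>2 - 1 \<ge> 0"
    unfolding q by simp
  moreover have "q \<ge> 0"
    using pos unfolding q_def by simp
  ultimately have "q \<ge> 1"
    using power2_le_imp_le[of 1 q] by simp
  then have "arcosh q = arsinh (sqrt ((t * cmod v / sqrt (E t))\<^sup>2))"
    by (simp only: arcosh_eq_arsinh q)
  then show ?thesis
    using d t E by simp
qed

lemma norm_Coefs_coefs_of_root:
  assumes z: "Im z > 0"
  shows "norm_Coefs (coefs_of_root z) (d_coefs z v) = cmod v / Im z"
proof -
  define E where "E t = (Im z)\<^sup>2 + 2 * t * Im z * Im v - t\<^sup>2 * (Re v)\<^sup>2" for t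
  have E0: "E 0 = (Im z)\<^sup>2"
    by (simp add: E_def)
  have "(E has_real_derivative 2 * Im z * Im v) (at 0)"
    unfolding E_def by (auto intro!: derivative_eq_intros)
  from DERIV_divide[OF DERIV_const DERIV_chain2[OF DERIV_real_sqrt this]]
  obtain K where "((\<lambda>t. cmod v / sqrt (E t)) has_real_derivative K) (at 0)"
    using z E0 by fastforce
  from DERIV_chain2[OF arsinh_real_has_field_derivative DERIV_mult[OF DERIV_ident this]]
  have "((\<lambda>t. arsinh (t * cmod v / sqrt (E t))) has_real_derivative cmod v / Im z) (at 0)"
    using z by (simp add: E0)
  then have "((\<lambda>t. arsinh (t * cmod v / sqrt (E t)) / t) \<longlongrightarrow> cmod v / Im z) (at 0)"
    by (simp add: has_field_derivative_iff)
  then have "((\<lambda>t. arsinh (t * cmod v / sqrt (E t)) / t) \<longlongrightarrow> cmod v / Im z) (at_right 0)"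
    by (rule filterlim_at_split[THEN iffD1, THEN conjunct2])
  moreover have "\<forall>\<^sub>F t in at_right 0. E t > 0"
  proof -
    have "(E \<longlongrightarrow> (Im z)\<^sup>2 + 2 * 0 * Im z * Im v - 0\<^sup>2 * (Re v)\<^sup>2) (at_right 0)"
      unfolding E_def by (intro tendsto_intros)
    from order_tendstoD(1)[OF this, of 0] show ?thesis
      using z by simp
  qed
  then have "\<forall>\<^sub>F t in at_right 0. arsinh (t * cmod v / sqrt (E t)) / t = dist_Coefs (coefs_of_root z)
      (affine_point (affine_chart (coefs_of_root z) + t *\<^sub>R d_coefs z v)) / t"
    using eventually_at_right_less[of 0]
    by eventually_elim (simp add: dist_Coefs_affine_line[OF z] E_def)
  ultimately have "((\<lambda>t. dist_Coefs (coefs_of_root z)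
      (affine_point (affine_chart (coefs_of_root z) + t *\<^sub>R d_coefs z v)) / t) \<longlongrightarrow> cmod v / Im z) (at_right 0)"
    by (rule Lim_transform_eventually)
  then show ?thesis
    unfolding norm_Coefs_def by (intro tendsto_Lim) simp_all
qed

lemma UT_Coefs_eq: "UT_Coefs = {(coefs_of_root z, d_coefs z v) | z v. Im z > 0 \<and> cmod v = Im z}"
proof (intro equalityI subsetI)
  fix u assume "u \<in> UT_Coefs"
  then obtain p w where u: "u = (p, w)" "p \<in> H2_Coefs" "norm_Coefs p w = 1"
    by (auto simp: UT_Coefs_def)
  obtain z where z: "Im z > 0" "p = coefs_of_root z"
    using u(2) by (rule H2_Coefs_cases)
  obtain v where v: "w = d_coefs z v"
    using bij_d_coefs[OF z(1)] by (metis bij_pointE)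
  have "cmod v = Im z"
    using u(3) z(1) norm_Coefs_coefs_of_root[OF z(1), of v] by (simp add: z(2) v)
  then show "u \<in> {(coefs_of_root z, d_coefs z v) | z v. Im z > 0 \<and> cmod v = Im z}"
    using u z v by blast
qed (auto simp: UT_Coefs_def norm_Coefs_coefs_of_root coefs_of_root_in_H2_Coefs)

section \<open>Cubic forms and the unit tangent bundle\<close>

definition linear_times_quadratic :: "real \<Rightarrow> real \<Rightarrow> complex \<Rightarrow> real \<times> real \<times> real \<times> real" where
  "linear_times_quadratic \<alpha> \<beta> z =
     (\<alpha>, \<beta> - 2 * Re z * \<alpha>, (cmod z)\<^sup>2 * \<alpha> - 2 * Re z * \<beta>, (cmod z)\<^sup>2 * \<beta>)"

lemma cubic_form_linear_times_quadratic:
  "cubic_form (linear_times_quadratic \<alpha> \<beta> z) (x, y)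
     = (of_real \<alpha> * x + of_real \<beta> * y) * ((x - z * y) * (x - cnj z * y))"
proof -
  have sum: "of_real (2 * Re z) = z + cnj z"
    by (simp add: complex_add_cnj)
  show ?thesis
    unfolding cubic_form_def linear_times_quadratic_def prod.case of_real_diff of_real_mult[of _ \<alpha>]
      of_real_mult[of _ \<beta>] sum complex_norm_square
    by (simp add: algebra_simps power2_eq_square power3_eq_cube del: complex_add_cnj)
qed

lemma cubic_roots_abs_proj:
  "f \<noteq> 0 \<Longrightarrow> cubic_roots (abs_proj f) = {w. cubic_form f (hom_coords w) = 0}"
  by (simp add: cubic_roots.abs_eq)

lemma linear_times_quadratic_scale:
  "linear_times_quadratic (k * \<alpha>) (k * \<beta>) z = k *\<^sub>R linear_times_quadratic \<alpha> \<beta> z"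
  by (simp add: linear_times_quadratic_def algebra_simps)

lemma linear_times_quadratic_nonzero:
  "\<alpha> \<noteq> 0 \<or> \<beta> \<noteq> 0 \<Longrightarrow> linear_times_quadratic \<alpha> \<beta> z \<noteq> 0"
  by (auto simp: linear_times_quadratic_def zero_prod_def)

fun cubic_of_roots :: "cp1 \<Rightarrow> complex \<Rightarrow> rp3" where
  "cubic_of_roots (Fin w) z = abs_proj (linear_times_quadratic 1 (- Re w) z)"
| "cubic_of_roots Inft z = abs_proj (linear_times_quadratic 0 1 z)"

lemma cubic_roots_cubic_of_roots:
  assumes "r \<in> rp1"
  shows "cubic_roots (cubic_of_roots r z) = {r, Fin z, Fin (cnj z)}"
proof -
  have "w \<in> cubic_roots (cubic_of_roots r z) \<longleftrightarrow> w \<in> {r, Fin z, Fin (cnj z)}" for w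
    using assms
    by (cases w) (auto simp: rp1_def cubic_roots_abs_proj linear_times_quadratic_nonzero
        cubic_form_linear_times_quadratic)
  then show ?thesis
    by blast
qed

lemma cubic_form_factors:
  assumes z: "Im z > 0" and root: "cubic_form f (z, 1) = 0"
  obtains \<alpha> \<beta> where "f = linear_times_quadratic \<alpha> \<beta> z"
proof -
  obtain a b c d where f: "f = (a, b, c, d)"
    by (cases f)
  define \<beta> where "\<beta> = b + 2 * Re z * a"
  define e g where "e = c - ((cmod z)\<^sup>2 * a - 2 * Re z * \<beta>)" and "g = d - (cmod z)\<^sup>2 * \<beta>"
  have "f = linear_times_quadratic a \<beta> z + (0, 0, e, g)"
    by (simp add: f linear_times_quadratic_def e_def g_def \<beta>_def)
  moreover have "cubic_form (u + v) p = cubic_form u p + cubic_form v p" for u v p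
    by (simp add: cubic_form_def algebra_simps split: prod.splits)
  ultimately have "cubic_form (0, 0, e, g) (z, 1) = 0"
    using root by (simp add: cubic_form_linear_times_quadratic)
  then have "of_real e * z + of_real g = 0"
    by (simp add: cubic_form_def)
  then have "e = 0" "g = 0"
    using z by (auto simp: complex_eq_iff)
  then show thesis
    using that[of a \<beta>] by (simp add: f linear_times_quadratic_def e_def g_def \<beta>_def)
qed

lemma cubic_determined_by_roots:
  assumes z: "Im z > 0" and r: "r \<in> rp1" and roots: "cubic_roots f = {r, Fin z, Fin (cnj z)}"
  shows "f = cubic_of_roots r z"
proof -
  obtain v where v: "v \<noteq> 0" "f = abs_proj v"
    by (rule abs_proj_cases)
  have root: "cubic_form v (hom_coords w) = 0" if "w \<in> {r, Fin z, Fin (cnj z)}" for w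
    using roots that v by (auto simp: cubic_roots_abs_proj)
  obtain \<alpha> \<beta> where ab: "v = linear_times_quadratic \<alpha> \<beta> z"
    using root[of "Fin z"] by (auto intro: cubic_form_factors[OF z])
  have nonzero: "\<alpha> \<noteq> 0 \<or> \<beta> \<noteq> 0"
    using v by (auto simp: ab linear_times_quadratic_def zero_prod_def)
  show ?thesis
  proof (cases r)
    case Inft
    then have "\<alpha> = 0"
      using root[of r] by (simp add: ab cubic_form_linear_times_quadratic)
    then have "v = \<beta> *\<^sub>R linear_times_quadratic 0 1 z" "\<beta> \<noteq> 0"
      using nonzero linear_times_quadratic_scale[of \<beta> 0 1 z] by (simp_all add: ab)
    then show ?thesis
      using abs_proj_scale[OF linear_times_quadratic_nonzero] by (simp add: v(2) Inft)
  next
    case (Fin w)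
    then obtain x where w: "w = of_real x"
      using r by (auto simp: rp1_def)
    have "w \<noteq> z" "w \<noteq> cnj z"
      using z by (auto simp: w complex_eq_iff)
    then have "of_real \<alpha> * w + of_real \<beta> = 0"
      using root[of r] by (simp add: ab Fin cubic_form_linear_times_quadratic)
    then have "of_real (\<alpha> * x + \<beta>) = (0 :: complex)"
      by (simp add: w)
    then have "\<alpha> * x + \<beta> = 0"
      by (rule of_real_eq_0_iff[THEN iffD1])
    then have \<beta>: "\<beta> = \<alpha> * (- x)"
      by simp
    then have "\<alpha> \<noteq> 0" "v = \<alpha> *\<^sub>R linear_times_quadratic 1 (- x) z"
      using nonzero linear_times_quadratic_scale[of \<alpha> 1 "- x" z] by (auto simp: ab)
    then show ?thesis
      using abs_proj_scale[OF linear_times_quadratic_nonzero] by (simp add: v(2) Fin w)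
  qed
qed

lemma root_set_eq_iff:
  assumes "r \<in> rp1" "r' \<in> rp1" "Im z > 0" "Im z' > 0"
  shows "{r, Fin z, Fin (cnj z)} = {r', Fin z', Fin (cnj z')} \<longleftrightarrow> r = r' \<and> z = z'"
proof
  assume eq: "{r, Fin z, Fin (cnj z)} = {r', Fin z', Fin (cnj z')}"
  have not_rp1: "Fin w \<notin> rp1" if "Im w \<noteq> 0" for w
    using that by (auto simp: rp1_def)
  have "{r, Fin z, Fin (cnj z)} \<inter> rp1 = {r}" "{r', Fin z', Fin (cnj z')} \<inter> rp1 = {r'}"
    using assms not_rp1 by auto
  then have "r = r'"
    using eq by simp
  have "Fin z \<noteq> r'"
    using assms not_rp1[of z] by auto
  moreover have "z \<noteq> cnj z'"
    using assms by (auto simp: complex_eq_iff)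
  moreover have "Fin z \<in> {r', Fin z', Fin (cnj z')}"
    using eq by blast
  ultimately show "r = r' \<and> z = z'"
    using \<open>r = r'\<close> by auto
qed auto

lemma X_eq: "X = {cubic_of_roots r z | r z. r \<in> rp1 \<and> Im z > 0}"
  unfolding X_def using cubic_determined_by_roots cubic_roots_cubic_of_roots by blast

lemma Psi_cubic_of_roots:
  assumes "r \<in> rp1" "Im z > 0"
  shows "Psi (cubic_of_roots r z) = (coefs_of_root z, d_coefs z (initial_vector z r))"
proof -
  have "Psi (cubic_of_roots r z) = d_R_2_inv (z, ray_direction z r)"
    unfolding Psi_def cubic_roots_cubic_of_roots[OF assms(1)]
    using assms by (intro the_equality) (auto simp: root_set_eq_iff)
  then show ?thesis
    using assms by (simp add: d_R_2_inv_eq ray_direction_eq)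
qed

lemma bij_betw_Psi: "bij_betw Psi X UT_Coefs"
proof -
  have "inj_on Psi X"
  proof (rule inj_onI)
    fix f f' assume "f \<in> X" "f' \<in> X" and eq: "Psi f = Psi f'"
    then obtain r z r' z' where f: "f = cubic_of_roots r z" "f' = cubic_of_roots r' z'"
      and rz: "r \<in> rp1" "r' \<in> rp1" "Im z > 0" "Im z' > 0"
      by (auto simp: X_eq)
    from eq have "coefs_of_root z = coefs_of_root z'"
      and d: "d_coefs z (initial_vector z r) = d_coefs z' (initial_vector z' r')"
      by (simp_all add: f rz Psi_cubic_of_roots)
    then have "z = z'"
      using rz R_2_coefs_of_root by metis
    moreover from this d have "initial_vector z r = initial_vector z r'"
      using bij_is_inj[OF bij_d_coefs[OF rz(3)]] by (simp add: inj_eq)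
    then have "r = r'"
      using bij_betw_imp_inj_on[OF bij_betw_initial_vector[OF rz(3)]] rz by (auto dest: inj_onD)
    ultimately show "f = f'"
      by (simp add: f)
  qed
  moreover have "Psi ` X = UT_Coefs"
  proof (intro equalityI subsetI)
    fix u assume "u \<in> Psi ` X"
    then obtain r z where "r \<in> rp1" "Im z > 0" "u = (coefs_of_root z, d_coefs z (initial_vector z r))"
      by (auto simp: X_eq Psi_cubic_of_roots)
    then show "u \<in> UT_Coefs"
      using bij_betwE[OF bij_betw_initial_vector] by (fastforce simp: UT_Coefs_eq)
  next
    fix u assume "u \<in> UT_Coefs"
    then obtain z v where z: "Im z > 0" and v: "cmod v = Im z" "u = (coefs_of_root z, d_coefs z v)"
      by (auto simp: UT_Coefs_eq)
    obtain r where "r \<in> rp1" "v = initial_vector z r"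
      using bij_betw_imp_surj_on[OF bij_betw_initial_vector[OF z]] v(1) by blast
    then show "u \<in> Psi ` X"
      using z v(2) Psi_cubic_of_roots by (auto simp: X_eq intro!: image_eqI[of _ Psi "cubic_of_roots r z"])
  qed
  ultimately show ?thesis
    by (simp add: bij_betw_def)
qed

lemma complex_root_unique:
  assumes "r \<in> rp1" "Im z > 0"
  shows "Im w > 0 \<and> Fin w \<in> cubic_roots (cubic_of_roots r z) \<longleftrightarrow> w = z"
  using assms by (auto simp: cubic_roots_cubic_of_roots rp1_def)

lemma bundle_proj_UT_Coefs: "bundle_proj ` UT_Coefs = H2_Coefs"
proof (intro equalityI subsetI)
  fix p assume "p \<in> H2_Coefs"
  then obtain z where z: "Im z > 0" "p = coefs_of_root z"
    by (rule H2_Coefs_cases)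
  then have "(p, d_coefs z (of_real (Im z))) \<in> UT_Coefs"
    by (force simp: UT_Coefs_eq)
  then show "p \<in> bundle_proj ` UT_Coefs"
    by (force simp: bundle_proj_def)
qed (auto simp: bundle_proj_def UT_Coefs_def)

theorem theorem4p14:
  "(\<forall>f\<in>X. \<exists>!z. Im z > 0 \<and> Fin z \<in> cubic_roots f) \<and>
   bij_betw Psi X UT_Coefs \<and>
   bundle_proj ` UT_Coefs = H2_Coefs \<and>
   bij_betw R_2 H2_Coefs H2_Roots \<and>
   (\<forall>p\<in>H2_Coefs. \<forall>q\<in>H2_Coefs. dist_Roots (R_2 p) (R_2 q) = dist_Coefs p q) \<and>
   (\<forall>f\<in>X. R_C f = (R_2 \<circ> bundle_proj \<circ> Psi) f)"
proof (intro conjI ballI)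
  show "dist_Roots (R_2 p) (R_2 q) = dist_Coefs p q" if "p \<in> H2_Coefs" "q \<in> H2_Coefs" for p q
    using that
    by (auto simp: R_2_coefs_of_root dist_Roots_eq_arcosh dist_Coefs_coefs_of_root elim!: H2_Coefs_cases)
  show "\<exists>!z. Im z > 0 \<and> Fin z \<in> cubic_roots f" if "f \<in> X" for f
  proof -
    obtain r z where "r \<in> rp1" "Im z > 0" "f = cubic_of_roots r z"
      using \<open>f \<in> X\<close> by (auto simp: X_eq)
    then show ?thesis
      by (simp add: complex_root_unique)
  qed
  show "R_C f = (R_2 \<circ> bundle_proj \<circ> Psi) f" if "f \<in> X" for f
    using that by (auto simp: X_eq R_C_def complex_root_unique Psi_cubic_of_roots bundle_proj_def R_2_coefs_of_root)
qed (rule bij_betw_Psi bundle_proj_UT_Coefs bij_betw_R_2)+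

end
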